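(* The equation $S\!E_4(a,b,c,g,u)$ admits shift operators for each of the shifts $a\to a\pm1$, $b\to b\pm1$, $c\to c\pm1$, $g\to g\pm2$ and $u\to u\pm1$ (in each shift the other parameters are kept fixed).
   Context: Notation: $\partial=d/dx$, $\theta=x\partial$; $a,b,c,g,u$ are complex parameters, assumed generic. The operator $E_4$: for exponents $e_1,\dots,e_8$ with $e_1+\cdots+e_8=4$, $E_4=\mathcal T_0+\mathcal T_1\partial+\mathcal T_2\partial^2$ with $\mathcal T_0=(\theta+e_5)(\theta+e_6)(\theta+e_7)(\theta+e_8)$, $\mathcal T_1=-2\theta^3+(s_{11}-s_{13}-5)\theta^2+(3s_{11}-s_{21}+s_{22}-s_{23}-8)\theta+\mathcal T_{10}$, $\mathcal T_2=(\theta-e_1+2)(\theta-e_2+2)$, $54\mathcal T_{10}=-4s_{11}^3+4s_{12}^3-(6s_{12}-27)s_{11}^2+(6s_{11}-27)s_{12}^2+(9s_{21}-18s_{22}+9s_{23}+36)s_{11}-(9s_{22}-18s_{21}+9s_{23}-18)s_{12}-81s_{21}+81s_{22}-27s_{23}-27s_3-135$, where $s_{11}=e_1+e_2$, $s_{12}=e_3+e_4$, $s_{13}=e_5+e_6+e_7+e_8$, $s_{21}=e_1e_2$, $s_{22}=e_3e_4$, $s_{23}=e_5e_6+e_5e_7+e_5e_8+e_6e_7+e_6e_8+e_7e_8$, $s_3=e_6e_7e_8+e_5e_7e_8+e_5e_6e_8+e_5e_6e_7$. The operator $S\!E_4(a,b,c,g,u)$ is $E_4$ with $e_1=2a+2c+g-u+2$,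 $e_2=a+c-u+1$, $e_3=2b+2c+g-u+2$, $e_4=b+c-u+1$, $e_5=u+1$, $e_6=u-a-b-2c-g-1$, $e_7=u-2c$, $e_8=u-2-g-2c-2b-2a$. Shift operator: let $E(\mathbf a)\in\mathbb C(x)[\partial]$ be an operator of order $n$ depending on parameters $\mathbf a$ and let $\mathbf a\to sh(\mathbf a)$ be a shift of the parameters. A shift operator of $E$ for this shift is a non-zero operator $P\in\mathbb C(x)[\partial]$ of order lower than $n$ that sends the solution space of $E(\mathbf a)$ into that of $E(sh(\mathbf a))$; equivalently, there is $Q\in\mathbb C(x)[\partial]$ with $E(sh(\mathbf a))\circ P=Q\circ E(\mathbf a)$. *)

theory Defs
  imports Complex_Main "HOL-Computational_Algebra.Computational_Algebra"
begin

section \<open>The differential field of rational functions\<close>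

type_synonym ratfun = "complex poly fract"

text \<open>The quotient rule; by \<open>fract_deriv_Fract\<close> the choice of numerator and denominator is immaterial.\<close>

definition fract_deriv :: "ratfun \<Rightarrow> ratfun" where
  "fract_deriv f =
    (let (p, q) = (SOME (p, q). q \<noteq> 0 \<and> f = Fract p q)
     in Fract (pderiv p * q - p * pderiv q) (q * q))"

lemma quotient_rule_unique:
  fixes p q r s p' q' r' s' :: "'a :: comm_ring_1"
  assumes "p * s = r * q" "p * s' + s * p' = r * q' + q * r'"
  shows "(p' * q - p * q') * (s * s) = (r' * s - r * s') * (q * q)"
proof -
  have "(p' * q - p * q') * (s * s) - (r' * s - r * s') * (q * q)
      = q * s * ((p * s' + s * p') - (r * q' + q * r')) - (q * s' + s * q') * (p * s - r * q)"
    by (simp add: algebra_simps)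
  thus ?thesis by (simp add: assms)
qed

lemma fract_deriv_Fract:
  assumes "s \<noteq> 0"
  shows "fract_deriv (Fract r s) = Fract (pderiv r * s - r * pderiv s) (s * s)"
proof -
  obtain p q where pq: "(SOME (p, q). q \<noteq> 0 \<and> Fract r s = Fract p q) = (p, q)"
    by (rule prod.exhaust)
  have "case (SOME (p, q). q \<noteq> 0 \<and> Fract r s = Fract p q) of
      (p, q) \<Rightarrow> q \<noteq> 0 \<and> Fract r s = Fract p q"
    by (rule someI[of "\<lambda>(p, q). q \<noteq> 0 \<and> Fract r s = Fract p q" "(r, s)"]) (simp add: assms)
  hence q: "q \<noteq> 0" and "Fract p q = Fract r s"
    by (simp_all add: pq)
  with q assms have eq: "p * s = r * q"
    by (simp add: eq_fract)
  hence "pderiv (p * s) = pderiv (r * q)" by simp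
  hence deq: "p * pderiv s + s * pderiv p = r * pderiv q + q * pderiv r"
    by (simp add: pderiv_mult)
  have "(pderiv p * q - p * pderiv q) * (s * s) = (pderiv r * s - r * pderiv s) * (q * q)"
    using eq deq by (rule quotient_rule_unique)
  thus ?thesis
    using q assms by (simp add: fract_deriv_def pq eq_fract)
qed

lemma fract_deriv_to_fract [simp]: "fract_deriv (to_fract p) = to_fract (pderiv p)"
  by (simp add: to_fract_def fract_deriv_Fract)

lemma fract_deriv_0 [simp]: "fract_deriv 0 = 0"
  and fract_deriv_1 [simp]: "fract_deriv 1 = 0"
  using fract_deriv_to_fract[of 0] fract_deriv_to_fract[of 1]
  by (simp_all del: fract_deriv_to_fract)

lemma fract_deriv_add: "fract_deriv (f + g) = fract_deriv f + fract_deriv g"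
  by (cases f; cases g) (simp add: fract_deriv_Fract eq_fract pderiv_mult pderiv_add algebra_simps)

lemma fract_deriv_mult: "fract_deriv (f * g) = fract_deriv f * g + f * fract_deriv g"
  by (cases f; cases g) (simp add: fract_deriv_Fract eq_fract pderiv_mult algebra_simps)


section \<open>The ring of differential operators with rational coefficients\<close>

text \<open>
  The operator with left coefficients \<open>p\<^sub>0, p\<^sub>1, \<dots>\<close>, that is \<open>\<Sum>i. p\<^sub>i \<partial>\<^sup>i\<close>, is represented by the
  polynomial with the same coefficients. A separate type is used because the product is
  composition of operators, not the commutative product of polynomials.
\<close>

typedef diffop = "UNIV :: ratfun poly set"
  morphisms coeffs_of Diffop by simp

setup_lifting type_definition_diffop

text \<open>
  Left composition with \<open>\<partial>\<close>: \<open>\<partial> \<circ> (\<Sum>i. q\<^sub>i \<partial>\<^sup>i) = (\<Sum>i. q\<^sub>i' \<partial>\<^sup>i) + (\<Sum>i. q\<^sub>i \<partial>\<^sup>i\<^sup>+\<^sup>1)\<close>.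
\<close>

definition deriv_comp :: "ratfun poly \<Rightarrow> ratfun poly" where
  "deriv_comp Q = map_poly fract_deriv Q + pCons 0 Q"

definition op_comp :: "ratfun poly \<Rightarrow> ratfun poly \<Rightarrow> ratfun poly" where
  "op_comp P Q = (\<Sum>i\<le>degree P. smult (coeff P i) ((deriv_comp ^^ i) Q))"

lemma map_fract_deriv_add:
  "map_poly fract_deriv (P + Q) = map_poly fract_deriv P + map_poly fract_deriv Q"
  by (intro poly_eqI) (simp add: coeff_map_poly fract_deriv_add)

lemma deriv_comp_add: "deriv_comp (P + Q) = deriv_comp P + deriv_comp Q"
  by (simp add: deriv_comp_def map_fract_deriv_add)

lemma deriv_comp_0 [simp]: "deriv_comp 0 = 0"
  by (simp add: deriv_comp_def)

lemma deriv_comp_smult: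
  "deriv_comp (smult f Q) = smult (fract_deriv f) Q + smult f (deriv_comp Q)"
  by (intro poly_eqI)
    (simp add: deriv_comp_def coeff_map_poly fract_deriv_mult coeff_pCons algebra_simps
      split: nat.splits)

lemma deriv_comp_pCons:
  "deriv_comp (pCons f Q) = pCons (fract_deriv f) (map_poly fract_deriv Q) + pCons 0 (pCons f Q)"
  by (simp add: deriv_comp_def map_poly_pCons)

lemma funpow_deriv_comp_add:
  "(deriv_comp ^^ i) (P + Q) = (deriv_comp ^^ i) P + (deriv_comp ^^ i) Q"
  by (induction i) (simp_all add: deriv_comp_add)

lemma op_comp_0_left [simp]: "op_comp 0 Q = 0"
  by (simp add: op_comp_def)

lemma op_comp_pCons: "op_comp (pCons f P) Q = smult f Q + op_comp P (deriv_comp Q)"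
proof (cases "P = 0")
  case False
  thus ?thesis
    by (simp add: op_comp_def sum.atMost_Suc_shift funpow_swap1 del: sum.atMost_Suc)
qed (simp add: op_comp_def)

lemma op_comp_add_right: "op_comp P (Q + R) = op_comp P Q + op_comp P R"
  by (simp add: op_comp_def funpow_deriv_comp_add smult_add_right sum.distrib)

lemma op_comp_add_left: "op_comp (P + Q) R = op_comp P R + op_comp Q R"
proof (induction P arbitrary: Q R rule: pCons_induct)
  case (pCons f P)
  show ?case
    by (cases Q) (simp add: op_comp_pCons pCons.IH smult_add_left)
qed simp

lemma op_comp_smult: "op_comp (smult f P) Q = smult f (op_comp P Q)"
  by (induction P arbitrary: Q rule: pCons_induct) (simp_all add: op_comp_pCons smult_add_right)

lemma op_comp_deriv_comp: "op_comp (deriv_comp Q) R = deriv_comp (op_comp Q R)"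
proof (induction Q arbitrary: R rule: pCons_induct)
  case (pCons f Q)
  have "op_comp (map_poly fract_deriv Q) (deriv_comp R) + op_comp Q (deriv_comp (deriv_comp R))
      = op_comp (deriv_comp Q) (deriv_comp R)"
    by (simp add: deriv_comp_def[of Q] op_comp_add_left op_comp_pCons)
  also have "\<dots> = deriv_comp (op_comp Q (deriv_comp R))"
    by (rule pCons.IH)
  finally show ?case
    by (simp add: deriv_comp_pCons op_comp_add_left op_comp_pCons deriv_comp_add
        deriv_comp_smult algebra_simps)
qed simp

lemma op_comp_assoc: "op_comp (op_comp P Q) R = op_comp P (op_comp Q R)"
  by (induction P arbitrary: Q rule: pCons_induct)
    (simp_all add: op_comp_pCons op_comp_add_left op_comp_smult op_comp_deriv_comp)

lemma op_comp_1_left: "op_comp 1 Q = Q"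
  by (simp add: one_pCons op_comp_pCons)

lemma op_comp_1_right: "op_comp P 1 = P"
proof -
  have "(deriv_comp ^^ i) 1 = monom 1 i" for i
  proof (induction i)
    case (Suc i)
    have "map_poly fract_deriv (monom 1 i) = 0"
      by (intro poly_eqI) (simp add: coeff_map_poly)
    hence "deriv_comp (monom 1 i) = monom 1 (Suc i)"
      by (simp add: deriv_comp_def monom_Suc)
    with Suc show ?case by simp
  qed simp
  thus ?thesis
    by (simp add: op_comp_def smult_monom poly_as_sum_of_monoms)
qed

instantiation diffop :: ring_1
begin

lift_definition zero_diffop :: diffop is 0 .
lift_definition one_diffop :: diffop is 1 .
lift_definition plus_diffop :: "diffop \<Rightarrow> diffop \<Rightarrow> diffop" is "(+)" .
lift_definition uminus_diffop :: "diffop \<Rightarrow> diffop" is uminus .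
lift_definition minus_diffop :: "diffop \<Rightarrow> diffop \<Rightarrow> diffop" is "(-)" .
lift_definition times_diffop :: "diffop \<Rightarrow> diffop \<Rightarrow> diffop" is op_comp .

instance
  by standard
    (transfer; simp add: op_comp_assoc op_comp_1_left op_comp_1_right
      op_comp_add_left op_comp_add_right)+

end

text \<open>The zero operator gets order 0.\<close>

lift_definition ord_op :: "diffop \<Rightarrow> nat" is degree .

definition mult_op :: "ratfun \<Rightarrow> diffop" where
  "mult_op f = Diffop [:f:]"

definition dx :: diffop  ("\<partial>") where
  "\<partial> = Diffop [:0, 1:]"

lemma dx_mult_op: "\<partial> * mult_op f = mult_op f * \<partial> + mult_op (fract_deriv f)"
  by (simp add: mult_op_def dx_def times_diffop.abs_eq plus_diffop.abs_eq op_comp_pCons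
      deriv_comp_def map_poly_pCons)

abbreviation const_op :: "complex \<Rightarrow> diffop" where
  "const_op k \<equiv> mult_op (to_fract [:k:])"

definition euler_op :: diffop  ("\<theta>") where
  "\<theta> = mult_op (to_fract [:0, 1:]) * \<partial>"


section \<open>The operators \<open>E\<^sub>4\<close> and \<open>SE\<^sub>4\<close>\<close>

definition E4_T10 :: "complex \<Rightarrow> complex \<Rightarrow> complex \<Rightarrow> complex \<Rightarrow> complex \<Rightarrow> complex \<Rightarrow> complex
    \<Rightarrow> complex \<Rightarrow> complex" where
  "E4_T10 e1 e2 e3 e4 e5 e6 e7 e8 =
    (let s11 = e1 + e2; s12 = e3 + e4;
         s21 = e1 * e2; s22 = e3 * e4;
         s23 = e5 * e6 + e5 * e7 + e5 * e8 + e6 * e7 + e6 * e8 + e7 * e8;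
         s3 = e6 * e7 * e8 + e5 * e7 * e8 + e5 * e6 * e8 + e5 * e6 * e7
     in (- 4 * s11 ^ 3 + 4 * s12 ^ 3 - (6 * s12 - 27) * s11 ^ 2 + (6 * s11 - 27) * s12 ^ 2
         + (9 * s21 - 18 * s22 + 9 * s23 + 36) * s11
         - (9 * s22 - 18 * s21 + 9 * s23 - 18) * s12
         - 81 * s21 + 81 * s22 - 27 * s23 - 27 * s3 - 135) / 54)"

text \<open>The exponents are meant to satisfy \<open>e\<^sub>1 + \<dots> + e\<^sub>8 = 4\<close>.\<close>

definition E4 :: "complex \<Rightarrow> complex \<Rightarrow> complex \<Rightarrow> complex \<Rightarrow> complex \<Rightarrow> complex \<Rightarrow> complex
    \<Rightarrow> complex \<Rightarrow> diffop" where
  "E4 e1 e2 e3 e4 e5 e6 e7 e8 =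
    (let s11 = e1 + e2; s13 = e5 + e6 + e7 + e8;
         s21 = e1 * e2; s22 = e3 * e4;
         s23 = e5 * e6 + e5 * e7 + e5 * e8 + e6 * e7 + e6 * e8 + e7 * e8;
         T0 = (\<theta> + const_op e5) * (\<theta> + const_op e6) * (\<theta> + const_op e7) * (\<theta> + const_op e8);
         T1 = - 2 * \<theta> ^ 3 + const_op (s11 - s13 - 5) * \<theta> ^ 2
              + const_op (3 * s11 - s21 + s22 - s23 - 8) * \<theta>
              + const_op (E4_T10 e1 e2 e3 e4 e5 e6 e7 e8);
         T2 = (\<theta> + const_op (2 - e1)) * (\<theta> + const_op (2 - e2))
     in T0 + T1 * \<partial> + T2 * \<partial> ^ 2)"

type_synonym params = "complex \<times> complex \<times> complex \<times> complex \<times> complex"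

fun SE4 :: "params \<Rightarrow> diffop" where
  "SE4 (a, b, c, g, u) =
    E4 (2*a + 2*c + g - u + 2) (a + c - u + 1) (2*b + 2*c + g - u + 2) (b + c - u + 1)
       (u + 1) (u - a - b - 2*c - g - 1) (u - 2*c) (u - 2 - g - 2*c - 2*b - 2*a)"

lemma SE4_exponents_sum:
  fixes a b c g u :: complex
  shows "(2*a + 2*c + g - u + 2) + (a + c - u + 1) + (2*b + 2*c + g - u + 2) + (b + c - u + 1)
    + (u + 1) + (u - a - b - 2*c - g - 1) + (u - 2*c) + (u - 2 - g - 2*c - 2*b - 2*a) = 4"
  by (simp add: algebra_simps)


section \<open>Shift operators\<close>

text \<open>
  \<open>P\<close> sends solutions of \<open>E \<aa>\<close> to solutions of \<open>E (sh \<aa>)\<close>; this is expressed inside the operator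
  ring by the intertwining relation \<open>E (sh \<aa>) \<circ> P = Q \<circ> E \<aa>\<close>.
\<close>

definition is_shift_operator ::
    "('p \<Rightarrow> diffop) \<Rightarrow> ('p \<Rightarrow> 'p) \<Rightarrow> 'p \<Rightarrow> diffop \<Rightarrow> bool" where
  "is_shift_operator E sh \<aa> P \<longleftrightarrow>
    P \<noteq> 0 \<and> ord_op P < ord_op (E \<aa>) \<and> (\<exists>Q. E (sh \<aa>) * P = Q * E \<aa>)"

text \<open>
  Polynomials in the five parameters are iterated univariate polynomials. A property holds for
  generic parameters if it holds off the zero set of some non-zero polynomial, i.e. on a non-empty
  Zariski open subset of the parameter space.
\<close>

fun eval_params :: "complex poly poly poly poly poly \<Rightarrow> params \<Rightarrow> complex" where
  "eval_params F (a, b, c, g, u) =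
    poly (poly (poly (poly (poly F [:[:[:[:a:]:]:]:]) [:[:[:b:]:]:]) [:[:c:]:]) [:g:]) u"

definition generically :: "(params \<Rightarrow> bool) \<Rightarrow> bool" where
  "generically R \<longleftrightarrow> (\<exists>F. F \<noteq> 0 \<and> (\<forall>\<aa>. eval_params F \<aa> \<noteq> 0 \<longrightarrow> R \<aa>))"

definition admits_shift_operator :: "(params \<Rightarrow> diffop) \<Rightarrow> (params \<Rightarrow> params) \<Rightarrow> bool" where
  "admits_shift_operator E sh \<longleftrightarrow> generically (\<lambda>\<aa>. \<exists>P. is_shift_operator E sh \<aa> P)"

end

theory Submission
  imports Defs "HOL-Library.Product_Plus"
begin

text \<open>
  In the variable \<open>s = \<theta> + u\<close> the operator \<open>SE\<^sub>4(a,b,c,g,u)\<close> is a polynomial in \<open>s\<close> and \<open>\<partial>\<close> that does not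
  involve \<open>u\<close>. Hence \<open>\<partial>\<close> realises the shift \<open>u \<rightarrow> u + 1\<close>, and it is invertible modulo
  \<open>SE\<^sub>4 = A \<partial> + e\<^sub>5 e\<^sub>6 e\<^sub>7 e\<^sub>8\<close> if no exponent at infinity vanishes. For \<open>a \<rightarrow> a - 1\<close> and for
  \<open>(a, u) \<rightarrow> (a + 1, u + 2)\<close> there are explicit operators of order 3, whose products are \<open>k \<partial>\<^sup>2\<close> modulo
  \<open>SE\<^sub>4\<close> with \<open>k\<close> a product of linear forms; so both are isomorphisms of solution spaces for
  generic parameters, and likewise for \<open>b\<close>. The affine maps of the parameters that permute the
  exponents \<open>e\<^sub>5, e\<^sub>7, e\<^sub>8\<close> and fix the others do not change \<open>SE\<^sub>4\<close>. Conjugating the shift of \<open>a\<close> with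
  them yields \<open>(b, c) \<rightarrow> (b + 1, c - 1)\<close> and \<open>(b, c, g, u) \<rightarrow> (b + 1, c + 1, g - 2, u + 2)\<close>, so that all
  required shifts are products of isomorphisms and of their inverses. An isomorphism becomes a
  shift operator after reduction modulo \<open>SE\<^sub>4\<close>.
\<close>

section \<open>Polynomials in the Euler operator\<close>

lemma mult_op_mult: "mult_op f * mult_op g = mult_op (f * g)"
  by (simp add: mult_op_def times_diffop.abs_eq op_comp_pCons)

lemma mult_op_add: "mult_op (f + g) = mult_op f + mult_op g"
  by (simp add: mult_op_def plus_diffop.abs_eq)

lemma mult_op_0 [simp]: "mult_op 0 = 0"
  by (simp add: mult_op_def zero_diffop_def)

lemma mult_op_1 [simp]: "mult_op 1 = 1"
  by (simp add: mult_op_def one_diffop_def one_pCons)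

lemma const_op_add: "const_op (c + d) = const_op c + const_op d"
  by (simp flip: mult_op_add to_fract_add)

lemma const_op_mult: "const_op (c * d) = const_op c * const_op d"
  by (simp add: mult_op_mult mult.commute flip: to_fract_mult)

lemma const_op_0 [simp]: "const_op 0 = 0"
  by simp

lemma const_op_1 [simp]: "const_op 1 = 1"
  by (simp flip: one_pCons)

text \<open>A multiplier with zero derivative can be pulled through \<open>deriv_comp\<close>, hence
  through every composition. Constants are therefore central.\<close>

lemma mult_op_commute:
  assumes "fract_deriv f = 0"
  shows "mult_op f * A = A * mult_op f"
proof (cases A)
  case (Diffop P)
  have "op_comp P (smult f Q) = smult f (op_comp P Q)" for Q
    by (induction P arbitrary: Q rule: pCons_induct)
      (simp_all add: op_comp_pCons deriv_comp_smult assms smult_add_right mult.commute)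
  from this[of 1] show ?thesis
    by (simp add: Diffop mult_op_def times_diffop.abs_eq op_comp_pCons op_comp_1_right)
qed

lemma const_op_commute: "const_op c * A = A * const_op c"
  by (rule mult_op_commute) (simp add: pderiv_pCons)

lemma dx_euler: "\<partial> * \<theta> = (\<theta> + 1) * \<partial>"
proof -
  have "\<partial> * mult_op (to_fract [:0, 1:]) = \<theta> + 1"
    by (simp add: dx_mult_op euler_op_def pderiv_pCons)
  thus ?thesis
    by (metis euler_op_def mult.assoc)
qed

text \<open>Evaluation at \<theta> by Horner's scheme. Since constants are central, it is a ring
  homomorphism from the commutative polynomials into the operators.\<close>

definition euler_poly :: "complex poly \<Rightarrow> diffop" where
  "euler_poly p = fold_coeffs (\<lambda>c A. const_op c + \<theta> * A) p 0"

lemma euler_poly_0 [simp]: "euler_poly 0 = 0"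
  by (simp add: euler_poly_def)

lemma euler_poly_pCons: "euler_poly (pCons c p) = const_op c + \<theta> * euler_poly p"
  by (cases "c = 0 \<and> p = 0")
    (auto simp: euler_poly_def fold_coeffs_pCons_coeff_not_0_eq fold_coeffs_pCons_not_0_0_eq)

lemma euler_poly_1 [simp]: "euler_poly 1 = 1"
  by (simp add: one_pCons euler_poly_pCons del: pCons_one)

lemma euler_poly_add: "euler_poly (p + q) = euler_poly p + euler_poly q"
  by (induction p q rule: poly_induct2) (simp_all add: euler_poly_pCons const_op_add algebra_simps)

lemma euler_poly_smult: "euler_poly (smult c p) = const_op c * euler_poly p"
proof (induction p)
  case (pCons d p)
  have "const_op c * (\<theta> * A) = \<theta> * (const_op c * A)" for A
    by (metis const_op_commute mult.assoc)
  with pCons show ?case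
    by (simp add: euler_poly_pCons const_op_mult distrib_left)
qed simp

lemma euler_poly_mult: "euler_poly (p * q) = euler_poly p * euler_poly q"
  by (induction p)
    (simp_all add: euler_poly_pCons euler_poly_add euler_poly_smult distrib_right mult.assoc)

lemma dx_euler_poly: "\<partial> * euler_poly p = euler_poly (pcompose p [:1, 1:]) * \<partial>"
proof (induction p)
  case (pCons c p)
  have "\<partial> * euler_poly (pCons c p) = const_op c * \<partial> + (\<theta> + 1) * (\<partial> * euler_poly p)"
    by (metis const_op_commute distrib_left dx_euler euler_poly_pCons mult.assoc)
  also have "\<dots> = (const_op c + (\<theta> + 1) * euler_poly (pcompose p [:1, 1:])) * \<partial>"
    by (simp add: pCons.IH distrib_right mult.assoc)
  also have "const_op c + (\<theta> + 1) * euler_poly (pcompose p [:1, 1:])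
      = euler_poly (pcompose (pCons c p) [:1, 1:])"
    by (simp add: pcompose_pCons euler_poly_add euler_poly_mult euler_poly_pCons algebra_simps
        del: mult_pCons_left)
  finally show ?case .
qed simp

lemma dx2_euler_poly: "\<partial> ^ 2 * euler_poly p = euler_poly (pcompose p [:2, 1:]) * \<partial> ^ 2"
proof -
  have "pcompose (pcompose p [:1, 1:]) [:1, 1:] = pcompose p [:2, 1:]"
    by (simp add: pcompose_assoc[symmetric] pcompose_pCons)
  thus ?thesis
    by (metis dx_euler_poly mult.assoc power2_eq_square)
qed

section \<open>Operators of degree at most two in \<partial>, with coefficients polynomial in
  \<theta> + u\<close>

lemma poly_ext:
  fixes p q :: "'a :: {comm_ring_1, ring_no_zero_divisors, ring_char_0} poly"
  assumes "\<And>t. poly p t = poly q t"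
  shows "p = q"
  using assms by (simp add: poly_eq_poly_eq_iff[symmetric] fun_eq_iff)

text \<open>The polynomials are meant in s = \<theta> + u, so that a change of u is just a
  translation of their argument.\<close>

definition weyl_op :: "complex \<Rightarrow> complex poly \<Rightarrow> complex poly \<Rightarrow> complex poly \<Rightarrow> diffop" where
  "weyl_op u f0 f1 f2 = euler_poly (pcompose f0 [:u, 1:]) + euler_poly (pcompose f1 [:u, 1:]) * \<partial>
    + euler_poly (pcompose f2 [:u, 1:]) * \<partial> ^ 2"

lemma mult_normal_ordered:
  "(euler_poly f0 + euler_poly f1 * \<partial> + euler_poly f2 * \<partial> ^ 2)
    * (euler_poly g0 + euler_poly g1 * \<partial> + euler_poly g2 * \<partial> ^ 2)
  = euler_poly (f0 * g0)
    + euler_poly (f0 * g1 + f1 * pcompose g0 [:1, 1:]) * \<partial>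
    + euler_poly (f0 * g2 + f1 * pcompose g1 [:1, 1:] + f2 * pcompose g0 [:2, 1:]) * \<partial> ^ 2
    + euler_poly (f1 * pcompose g2 [:1, 1:] + f2 * pcompose g1 [:2, 1:]) * \<partial> ^ 3
    + euler_poly (f2 * pcompose g2 [:2, 1:]) * \<partial> ^ 4"
proof -
  \<comment> \<open>The rules carry a left factor \<open>A\<close> because distributing leaves the
    powers of \<partial> in the middle of products.\<close>
  have 1: "A * \<partial> * (euler_poly p * B) = A * euler_poly (pcompose p [:1, 1:]) * (\<partial> * B)" for A B p
    by (metis dx_euler_poly mult.assoc)
  have x1: "A * \<partial> * euler_poly p = A * euler_poly (pcompose p [:1, 1:]) * \<partial>" for A p
    by (metis dx_euler_poly mult.assoc)
  have 2: "A * \<partial>\<^sup>2 * (euler_poly p * B) = A * euler_poly (pcompose p [:2, 1:]) * (\<partial>\<^sup>2 * B)" for A B p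
    by (metis dx2_euler_poly mult.assoc)
  have x2: "A * \<partial>\<^sup>2 * euler_poly p = A * euler_poly (pcompose p [:2, 1:]) * \<partial>\<^sup>2" for A p
    by (metis dx2_euler_poly mult.assoc)
  have pow: "\<partial> * \<partial> = \<partial>\<^sup>2" "\<partial> * \<partial>\<^sup>2 = \<partial> ^ 3" "\<partial>\<^sup>2 * \<partial> = \<partial> ^ 3" "\<partial>\<^sup>2 * \<partial>\<^sup>2 = \<partial> ^ 4"
    by (simp_all add: eval_nat_numeral mult.assoc)
  show ?thesis
    by (simp only: distrib_left distrib_right 1 x1 2 x2 pow euler_poly_add euler_poly_mult)
      (simp add: mult.assoc)
qed

text \<open>Comparison of the coefficients of \<partial>^0 to \<partial>^4 in normal order, with s =
  \<theta> + u read as a number. Noncommutative identities thus become polynomial identities that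
  \<open>algebra\<close> decides; the offsets \<open>i\<close>, \<open>j\<close>, \<open>k\<close>,
  \<open>m\<close> allow a different u in each factor.\<close>

lemma weyl_op_mult_eq:
  assumes "\<And>s. poly f0 (s + i) * poly g0 (s + j) = poly h0 (s + k) * poly l0 (s + m)"
    and "\<And>s. poly f0 (s + i) * poly g1 (s + j) + poly f1 (s + i) * poly g0 (s + j + 1)
      = poly h0 (s + k) * poly l1 (s + m) + poly h1 (s + k) * poly l0 (s + m + 1)"
    and "\<And>s. poly f0 (s + i) * poly g2 (s + j) + poly f1 (s + i) * poly g1 (s + j + 1)
        + poly f2 (s + i) * poly g0 (s + j + 2)
      = \<kappa> + poly h0 (s + k) * poly l2 (s + m) + poly h1 (s + k) * poly l1 (s + m + 1)
        + poly h2 (s + k) * poly l0 (s + m + 2)"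
    and "\<And>s. poly f1 (s + i) * poly g2 (s + j + 1) + poly f2 (s + i) * poly g1 (s + j + 2)
      = poly h1 (s + k) * poly l2 (s + m + 1) + poly h2 (s + k) * poly l1 (s + m + 2)"
    and "\<And>s. poly f2 (s + i) * poly g2 (s + j + 2) = poly h2 (s + k) * poly l2 (s + m + 2)"
  shows "weyl_op (u + i) f0 f1 f2 * weyl_op (u + j) g0 g1 g2
    = const_op \<kappa> * \<partial> ^ 2 + weyl_op (u + k) h0 h1 h2 * weyl_op (u + m) l0 l1 l2"
proof -
  let ?C = "\<lambda>p d. pcompose p [:u + d, 1:]"
  have "?C f0 i * ?C g0 j = ?C h0 k * ?C l0 m"
    by (rule poly_ext) (use assms(1)[of "t + u" for t] in \<open>simp add: poly_pcompose ac_simps\<close>)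
  moreover have "?C f0 i * ?C g1 j + ?C f1 i * pcompose (?C g0 j) [:1, 1:]
      = ?C h0 k * ?C l1 m + ?C h1 k * pcompose (?C l0 m) [:1, 1:]"
    by (rule poly_ext) (use assms(2)[of "t + u" for t] in \<open>simp add: poly_pcompose ac_simps\<close>)
  moreover have "?C f0 i * ?C g2 j + ?C f1 i * pcompose (?C g1 j) [:1, 1:]
      + ?C f2 i * pcompose (?C g0 j) [:2, 1:]
      = [:\<kappa>:] + (?C h0 k * ?C l2 m + ?C h1 k * pcompose (?C l1 m) [:1, 1:]
        + ?C h2 k * pcompose (?C l0 m) [:2, 1:])"
    by (rule poly_ext) (use assms(3)[of "t + u" for t] in \<open>simp add: poly_pcompose ac_simps\<close>)
  moreover have "?C f1 i * pcompose (?C g2 j) [:1, 1:] + ?C f2 i * pcompose (?C g1 j) [:2, 1:]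
      = ?C h1 k * pcompose (?C l2 m) [:1, 1:] + ?C h2 k * pcompose (?C l1 m) [:2, 1:]"
    by (rule poly_ext) (use assms(4)[of "t + u" for t] in \<open>simp add: poly_pcompose ac_simps\<close>)
  moreover have "?C f2 i * pcompose (?C g2 j) [:2, 1:] = ?C h2 k * pcompose (?C l2 m) [:2, 1:]"
    by (rule poly_ext) (use assms(5)[of "t + u" for t] in \<open>simp add: poly_pcompose ac_simps\<close>)
  ultimately show ?thesis
    by (simp only: weyl_op_def mult_normal_ordered)
      (simp add: euler_poly_add[of "[:\<kappa>:]"] distrib_right euler_poly_pCons add.assoc)
qed

lemma weyl_op_mult_eq_0:
  assumes "\<And>s. poly f0 (s + i) * poly g0 (s + j) = poly h0 (s + k) * poly l0 (s + m)"
    and "\<And>s. poly f0 (s + i) * poly g1 (s + j) + poly f1 (s + i) * poly g0 (s + j + 1)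
      = poly h0 (s + k) * poly l1 (s + m) + poly h1 (s + k) * poly l0 (s + m + 1)"
    and "\<And>s. poly f0 (s + i) * poly g2 (s + j) + poly f1 (s + i) * poly g1 (s + j + 1)
        + poly f2 (s + i) * poly g0 (s + j + 2)
      = poly h0 (s + k) * poly l2 (s + m) + poly h1 (s + k) * poly l1 (s + m + 1)
        + poly h2 (s + k) * poly l0 (s + m + 2)"
    and "\<And>s. poly f1 (s + i) * poly g2 (s + j + 1) + poly f2 (s + i) * poly g1 (s + j + 2)
      = poly h1 (s + k) * poly l2 (s + m + 1) + poly h2 (s + k) * poly l1 (s + m + 2)"
    and "\<And>s. poly f2 (s + i) * poly g2 (s + j + 2) = poly h2 (s + k) * poly l2 (s + m + 2)"
  shows "weyl_op (u + i) f0 f1 f2 * weyl_op (u + j) g0 g1 g2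
    = weyl_op (u + k) h0 h1 h2 * weyl_op (u + m) l0 l1 l2"
  using weyl_op_mult_eq[of f0 i g0 j h0 k l0 m g1 f1 l1 h1 g2 f2 0 l2 h2 u] assms by simp

section \<open>Equivalence of differential operators\<close>

definition left_ideal :: "diffop \<Rightarrow> diffop set" where
  "left_ideal E = range (\<lambda>R. R * E)"

lemma left_ideal_self [intro]: "E \<in> left_ideal E"
  unfolding left_ideal_def by (rule range_eqI[of _ _ 1]) simp

lemma left_ideal_add: "A \<in> left_ideal E \<Longrightarrow> B \<in> left_ideal E \<Longrightarrow> A + B \<in> left_ideal E"
  unfolding left_ideal_def by (auto simp flip: distrib_right)

lemma left_ideal_diff: "A \<in> left_ideal E \<Longrightarrow> B \<in> left_ideal E \<Longrightarrow> A - B \<in> left_ideal E"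
  unfolding left_ideal_def by (auto simp flip: left_diff_distrib)

lemma left_ideal_mult: "A \<in> left_ideal E \<Longrightarrow> Z * A \<in> left_ideal E"
  unfolding left_ideal_def by (auto simp flip: mult.assoc)

text \<open>This says that right multiplication by \<open>P\<close> is well defined from D / D E to
  D / D F.\<close>

lemma left_ideal_mult_trans: "A \<in> left_ideal E \<Longrightarrow> E * P \<in> left_ideal F \<Longrightarrow> A * P \<in> left_ideal F"
  unfolding left_ideal_def by (auto simp: mult.assoc) (metis mult.assoc rangeI)

text \<open>
  Right multiplication by \<open>P\<close> and \<open>P'\<close> induces mutually inverse isomorphisms between the left
  modules \<open>D / D E\<close> and \<open>D / D F\<close>; equivalently \<open>P\<close> and \<open>P'\<close> are mutually inverse between the
  solution spaces of \<open>E\<close> and \<open>F\<close>.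
\<close>

definition inverse_pair :: "diffop \<Rightarrow> diffop \<Rightarrow> diffop \<Rightarrow> diffop \<Rightarrow> bool" where
  "inverse_pair E F P P' \<longleftrightarrow> F * P \<in> left_ideal E \<and> E * P' \<in> left_ideal F
    \<and> P' * P - 1 \<in> left_ideal E \<and> P * P' - 1 \<in> left_ideal F"

definition equivalent_op :: "diffop \<Rightarrow> diffop \<Rightarrow> bool" where
  "equivalent_op E F \<longleftrightarrow> (\<exists>P P'. inverse_pair E F P P')"

lemma equivalent_op_sym: "equivalent_op E F \<Longrightarrow> equivalent_op F E"
  unfolding equivalent_op_def inverse_pair_def by blast

lemma mult_left_ideal_comp:
  assumes "F * P \<in> left_ideal E" "G * S \<in> left_ideal F"
  shows "G * (S * P) \<in> left_ideal E"
  using left_ideal_mult_trans[OF assms(2,1)] by (simp add: mult.assoc)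

lemma inverse_pair_comp:
  assumes "inverse_pair E F P P'" "inverse_pair F G S S'"
  shows "inverse_pair E G (S * P) (P' * S')"
proof -
  \<comment> \<open>Stated for arbitrary operators because it serves both composites: the second use
    exchanges the roles of the two sides.\<close>
  have aux: "P' * S' * (S * P) - 1 \<in> left_ideal E"
    if "F * P \<in> left_ideal E" "P' * P - 1 \<in> left_ideal E" "S' * S - 1 \<in> left_ideal F"
    for E F P P' S S'
  proof -
    have "(S' * S - 1) * P \<in> left_ideal E"
      using that by (blast intro: left_ideal_mult_trans)
    hence "P' * ((S' * S - 1) * P) + (P' * P - 1) \<in> left_ideal E"
      using that by (blast intro: left_ideal_add left_ideal_mult)
    thus ?thesis by (simp add: algebra_simps)
  qed
  show ?thesis
    using assms aux[of F P E P' S' S] aux[of F S' G S P P'] 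
    unfolding inverse_pair_def by (auto intro: mult_left_ideal_comp)
qed

lemma equivalent_op_trans: "equivalent_op E F \<Longrightarrow> equivalent_op F G \<Longrightarrow> equivalent_op E G"
  unfolding equivalent_op_def by (blast intro: inverse_pair_comp)

lemma inverse_pair_scale:
  assumes "inverse_pair E F P P'" "c \<noteq> 0"
  shows "inverse_pair E F (const_op c * P) (const_op (1 / c) * P')"
proof -
  have 1: "const_op (1 / c) * const_op c = 1" "const_op c * const_op (1 / c) = 1"
    using assms(2) by (simp_all flip: const_op_mult)
  have "const_op (1 / c) * P' * (const_op c * P) = const_op (1 / c) * const_op c * (P' * P)"
    "const_op c * P * (const_op (1 / c) * P') = const_op c * const_op (1 / c) * (P * P')"
    by (metis const_op_commute mult.assoc)+
  moreover have "F * (const_op c * P) = const_op c * (F * P)"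
    "E * (const_op (1 / c) * P') = const_op (1 / c) * (E * P')"
    by (metis const_op_commute mult.assoc)+
  ultimately show ?thesis
    using assms(1) unfolding inverse_pair_def by (simp add: 1 left_ideal_mult)
qed

text \<open>
  The two-out-of-six argument: if \<open>S P\<close> and \<open>T S\<close> are invertible, then \<open>P\<close> has a left inverse, and \<open>S\<close>
  has one as well, so that the left inverse \<open>U' S\<close> of \<open>P\<close> is also a right inverse.
\<close>

lemma equivalent_op_two_out_of_six:
  assumes P: "F * P \<in> left_ideal E" and S: "G * S \<in> left_ideal F"
    and U: "inverse_pair E G U U'" and V: "inverse_pair F H V V'"
    and SP: "S * P - U \<in> left_ideal E" and TS: "T * S - V \<in> left_ideal F"
  shows "equivalent_op E F"
proof -
  have U': "E * U' \<in> left_ideal G" "U' * U - 1 \<in> left_ideal E" "U * U' - 1 \<in> left_ideal G"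
    and V': "V' * V - 1 \<in> left_ideal F"
    using U V unfolding inverse_pair_def by auto
  have US: "E * (U' * S) \<in> left_ideal F"
    using U'(1) S by (rule mult_left_ideal_comp[rotated])
  have left: "U' * S * P - 1 \<in> left_ideal E"
  proof -
    have "U' * (S * P - U) + (U' * U - 1) \<in> left_ideal E"
      by (intro left_ideal_add left_ideal_mult SP U')
    thus ?thesis by (simp add: algebra_simps)
  qed
  have L: "V' * T * S - 1 \<in> left_ideal F"
  proof -
    have "V' * (T * S - V) + (V' * V - 1) \<in> left_ideal F"
      by (intro left_ideal_add left_ideal_mult TS V')
    thus ?thesis by (simp add: algebra_simps)
  qed
  have "S * (P * (U' * S)) - S \<in> left_ideal F"
  proof -
    have "(S * P - U) * (U' * S) + (U * U' - 1) * S \<in> left_ideal F"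
      by (intro left_ideal_add left_ideal_mult_trans[OF SP US] left_ideal_mult_trans[OF U'(3) S])
    thus ?thesis by (simp add: algebra_simps)
  qed
  hence "V' * T * (S * (P * (U' * S)) - S) \<in> left_ideal F"
    by (rule left_ideal_mult)
  moreover have "(V' * T * S - 1) * (P * (U' * S)) \<in> left_ideal F"
    using L mult_left_ideal_comp[OF US P] by (rule left_ideal_mult_trans)
  \<comment> \<open>\<open>V' * T\<close> is a left inverse of \<open>S\<close> modulo
    \<open>F\<close> and cancels it; the sum expands to \<open>P * (U' * S) - 1\<close>.\<close>
  ultimately have "V' * T * (S * (P * (U' * S)) - S) - (V' * T * S - 1) * (P * (U' * S))
      + (V' * T * S - 1) \<in> left_ideal F"
    using L by (rule left_ideal_add[OF left_ideal_diff])
  hence "P * (U' * S) - 1 \<in> left_ideal F"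
    by (simp add: algebra_simps)
  with P US left show ?thesis
    unfolding equivalent_op_def inverse_pair_def by blast
qed

section \<open>Orders and right division\<close>

text \<open>The coefficient \<open>f\<close> may be zero, so sums and differences need no case
  distinction on cancellation of leading terms.\<close>

definition order_le :: "nat \<Rightarrow> ratfun \<Rightarrow> diffop \<Rightarrow> bool" where
  "order_le n f A \<longleftrightarrow> degree (coeffs_of A) \<le> n \<and> coeff (coeffs_of A) n = f"

lemma coeffs_of_simps:
  "coeffs_of 0 = 0" "coeffs_of 1 = 1" "coeffs_of (A + B) = coeffs_of A + coeffs_of B"
  "coeffs_of (A - B) = coeffs_of A - coeffs_of B" "coeffs_of (A * B) = op_comp (coeffs_of A) (coeffs_of B)"
  by (transfer; simp)+

lemma order_le_add: "order_le n f A \<Longrightarrow> order_le n g B \<Longrightarrow> order_le n (f + g) (A + B)"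
  by (auto simp: order_le_def coeffs_of_simps intro: degree_add_le)

lemma order_le_diff: "order_le n f A \<Longrightarrow> order_le n g B \<Longrightarrow> order_le n (f - g) (A - B)"
  by (auto simp: order_le_def coeffs_of_simps intro: degree_diff_le)

lemma order_le_weaken: "order_le n f A \<Longrightarrow> n < m \<Longrightarrow> order_le m 0 A"
  by (auto simp: order_le_def coeff_eq_0)

lemma degree_coeff_deriv_comp:
  assumes "degree Q \<le> n"
  shows "degree (deriv_comp Q) \<le> Suc n \<and> coeff (deriv_comp Q) (Suc n) = coeff Q n"
proof -
  have "degree (map_poly fract_deriv Q) \<le> n"
    using assms by (intro degree_le) (simp add: coeff_map_poly coeff_eq_0)
  thus ?thesis
    using assms
    by (auto simp: deriv_comp_def coeff_eq_0 degree_pCons_eq_if intro!: degree_add_le)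
qed

text \<open>Commuting \<partial> past a coefficient only creates terms of lower order, so top
  coefficients multiply as in the commutative case.\<close>

lemma degree_coeff_op_comp:
  assumes "degree P \<le> m" "degree Q \<le> n"
  shows "degree (op_comp P Q) \<le> m + n \<and> coeff (op_comp P Q) (m + n) = coeff P m * coeff Q n"
  using assms
proof (induction P arbitrary: Q m n rule: pCons_induct)
  case (pCons f P)
  show ?case
  proof (cases m)
    case 0
    with pCons have "P = 0" by (auto split: if_splits)
    thus ?thesis using pCons.prems 0 by (auto simp: op_comp_pCons intro: order.trans[OF degree_smult_le])
  next
    case (Suc k)
    have "degree P \<le> k"
      using pCons.prems(1) Suc by (auto split: if_splits)
    from pCons.IH[OF this, of "deriv_comp Q" "Suc n"] degree_coeff_deriv_comp[OF pCons.prems(2)]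
    have "degree (op_comp P (deriv_comp Q)) \<le> m + n"
      "coeff (op_comp P (deriv_comp Q)) (m + n) = coeff P k * coeff Q n"
      by (simp_all add: Suc)
    thus ?thesis
      using pCons.prems(2) Suc
      by (auto simp: op_comp_pCons coeff_eq_0 intro!: degree_add_le order.trans[OF degree_smult_le])
  qed
qed auto

lemma order_le_mult: "order_le m f A \<Longrightarrow> order_le n g B \<Longrightarrow> order_le (m + n) (f * g) (A * B)"
  using degree_coeff_op_comp by (auto simp: order_le_def coeffs_of_simps)

lemma order_le_mult_op: "order_le 0 f (mult_op f)"
  by (simp add: order_le_def mult_op_def Diffop_inverse)

lemma order_le_dx: "order_le 1 1 \<partial>"
  by (simp add: order_le_def dx_def Diffop_inverse)

lemma order_le_dx_power: "order_le n 1 (\<partial> ^ n)"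
proof (induction n)
  case 0
  show ?case using order_le_mult_op[of 1] by simp
next
  case (Suc n)
  show ?case using order_le_mult[OF order_le_dx Suc] by simp
qed

lemma order_le_euler: "order_le 1 (to_fract [:0, 1:]) \<theta>"
  using order_le_mult[OF order_le_mult_op order_le_dx, of "to_fract [:0, 1:]"]
  by (simp add: euler_op_def)

lemma ord_op_eqI: "order_le n f A \<Longrightarrow> f \<noteq> 0 \<Longrightarrow> ord_op A = n"
  by (metis le_antisym le_degree ord_op.rep_eq order_le_def)

text \<open>Division from the top: the leading coefficient \<open>e\<close> is invertible in the
  field of rational functions, so a left multiple of \<open>E\<close> removes the top term. The
  induction is on the excess \<open>m\<close> of the order over \<open>n\<close>.\<close>

lemma right_division:
  assumes E: "order_le (Suc n) e E" "e \<noteq> 0"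
  shows "\<exists>S R. A = S * E + R \<and> ord_op R \<le> n"
proof -
  have "\<exists>S. ord_op (A - S * E) \<le> n" if "ord_op A \<le> m + n" for m
    using that
  proof (induction m arbitrary: A)
    case 0
    show ?case by (rule exI[of _ 0]) (use 0 in simp)
  next
    case (Suc m)
    let ?f = "coeff (coeffs_of A) (Suc m + n)"
    let ?S = "mult_op (?f / e) * \<partial> ^ m"
    have "order_le (Suc m + n) ?f A"
      using Suc.prems by (simp add: order_le_def ord_op.rep_eq)
    moreover have "order_le (Suc m + n) ?f (?S * E)"
      using order_le_mult[OF order_le_mult[OF order_le_mult_op[of "?f / e"] order_le_dx_power[of m]] E(1)]
        E(2) by simp
    ultimately have "order_le (Suc m + n) 0 (A - ?S * E)"
      using order_le_diff by fastforce
    hence "ord_op (A - ?S * E) \<le> m + n"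
      unfolding order_le_def ord_op.rep_eq
      by (metis add_Suc degree_0 le_Suc_eq leading_coeff_0_iff le0)
    from Suc.IH[OF this] obtain S where "ord_op (A - (?S + S) * E) \<le> n"
      by (auto simp: algebra_simps)
    thus ?case by blast
  qed
  from this[of "ord_op A"] obtain S where "ord_op (A - S * E) \<le> n" by auto
  thus ?thesis
    by (intro exI[of _ S] exI[of _ "A - S * E"]) simp
qed

text \<open>Leading coefficients multiply without cancelling, so a nonzero left multiple of
  \<open>E\<close> has positive order.\<close>

lemma one_not_in_left_ideal:
  assumes "order_le (Suc n) e E" "e \<noteq> 0"
  shows "1 \<notin> left_ideal E"
proof
  assume "1 \<in> left_ideal E"
  then obtain Z where Z: "1 = Z * E"
    by (auto simp: left_ideal_def)
  let ?f = "coeff (coeffs_of Z) (ord_op Z)"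
  have "order_le (ord_op Z) ?f Z"
    by (simp add: order_le_def ord_op.rep_eq)
  hence "order_le (ord_op Z + Suc n) (?f * e) (1 :: diffop)"
    using order_le_mult assms(1) Z by metis
  hence "?f = 0"
    using assms(2) by (simp add: order_le_def coeffs_of_simps)
  hence "coeffs_of Z = 0"
    by (simp add: ord_op.rep_eq)
  hence "Z = 0"
    by (metis coeffs_of_inject coeffs_of_simps(1))
  with Z show False by simp
qed

text \<open>The remainder of the intertwiner \<open>P\<close> modulo \<open>E \<aa>\<close> still
  intertwines and has smaller order. It is nonzero: otherwise \<open>P\<close>, and with it 1, would
  lie in the left ideal of \<open>E \<aa>\<close>.\<close>

lemma equivalent_op_imp_shift_operator:
  assumes "equivalent_op (E \<aa>) (E (sh \<aa>))" "order_le (Suc n) e (E \<aa>)" "e \<noteq> 0"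
  shows "\<exists>P. is_shift_operator E sh \<aa> P"
proof -
  obtain P P' where P: "E (sh \<aa>) * P \<in> left_ideal (E \<aa>)" "P' * P - 1 \<in> left_ideal (E \<aa>)"
    using assms(1) by (auto simp: equivalent_op_def inverse_pair_def)
  obtain S R where R: "P = S * E \<aa> + R" "ord_op R \<le> n"
    using right_division[OF assms(2,3)] by blast
  have SE: "Z * (S * E \<aa>) \<in> left_ideal (E \<aa>)" for Z
    by (intro left_ideal_mult left_ideal_self)
  have "R \<noteq> 0"
  proof
    assume "R = 0"
    hence "P' * (S * E \<aa>) - (P' * P - 1) = 1"
      by (simp add: R)
    hence "1 \<in> left_ideal (E \<aa>)"
      using left_ideal_diff[OF SE P(2)] by metis
    thus False
      using one_not_in_left_ideal[OF assms(2,3)] by blast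
  qed
  moreover have "ord_op R < ord_op (E \<aa>)"
    using R(2) ord_op_eqI[OF assms(2,3)] by simp
  moreover have "E (sh \<aa>) * R = E (sh \<aa>) * P - E (sh \<aa>) * (S * E \<aa>)"
    by (simp add: R(1) algebra_simps)
  hence "E (sh \<aa>) * R \<in> left_ideal (E \<aa>)"
    using left_ideal_diff[OF P(1) SE] by simp
  ultimately show ?thesis
    unfolding is_shift_operator_def left_ideal_def by auto
qed

section \<open>The operator \<open>SE\<^sub>4\<close> in terms of \<open>\<theta> + u\<close>\<close>

lemma euler_poly_X [simp]: "euler_poly [:c, 1:] = \<theta> + const_op c"
  by (simp add: euler_poly_pCons one_pCons[symmetric])

text \<open>Each of \<open>e\<^sub>5\<close> to \<open>e\<^sub>8\<close> is u plus a term free of u,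
  so u disappears once the product is written in s.\<close>

definition se_T0 :: "complex \<Rightarrow> complex \<Rightarrow> complex \<Rightarrow> complex \<Rightarrow> complex poly" where
  "se_T0 a b c g = [:1, 1:] * [:- a - b - 2*c - g - 1, 1:] * [:- 2*c, 1:]
    * [:- 2 - g - 2*c - 2*b - 2*a, 1:]"

definition se_T1 :: "complex \<Rightarrow> complex \<Rightarrow> complex \<Rightarrow> complex \<Rightarrow> complex poly" where
  "se_T1 a b c g = [:c*g^2 + 4*c^2*g + 4*c^3 + 2*b*c*g + 4*b*c^2 + 4*a*c*g + 8*a*c^2 + 4*a*b*c
      + 4*a^2*c - g^2 - 5*c*g - 6*c^2 - 2*b*g - 6*b*c - 4*a*g - 10*a*c - 4*a*b - 4*a^2 - g
      - 4*c - 2*a,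
    - (g^2) - 8*c*g - 12*c^2 - 2*b*g - 8*b*c - 4*a*g - 16*a*c - 4*a*b - 4*a^2 + 2*g + 3*c + 3*b
      + 4*a + 2,
    3*g + 9*c + 3*b + 6*a, - 2:]"

definition se_T2 :: "complex \<Rightarrow> complex \<Rightarrow> complex \<Rightarrow> complex poly" where
  "se_T2 a c g = [:- 2*a - 2*c - g, 1:] * [:1 - a - c, 1:]"

lemma SE4_eq_weyl_op: "SE4 (a, b, c, g, u) = weyl_op u (se_T0 a b c g) (se_T1 a b c g) (se_T2 a c g)"
proof -
  define e1 e2 e3 e4 e5 e6 e7 e8 where e_def:
    "e1 = 2*a + 2*c + g - u + 2" "e2 = a + c - u + 1" "e3 = 2*b + 2*c + g - u + 2" "e4 = b + c - u + 1"
    "e5 = u + 1" "e6 = u - a - b - 2*c - g - 1" "e7 = u - 2*c" "e8 = u - 2 - g - 2*c - 2*b - 2*a"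
  define s11 s13 s21 s22 s23 where s_def:
    "s11 = e1 + e2" "s13 = e5 + e6 + e7 + e8" "s21 = e1 * e2" "s22 = e3 * e4"
    "s23 = e5 * e6 + e5 * e7 + e5 * e8 + e6 * e7 + e6 * e8 + e7 * e8"
  have T0: "(\<theta> + const_op e5) * (\<theta> + const_op e6) * (\<theta> + const_op e7) * (\<theta> + const_op e8)
      = euler_poly (pcompose (se_T0 a b c g) [:u, 1:])"
  proof -
    have "pcompose (se_T0 a b c g) [:u, 1:] = [:e5, 1:] * [:e6, 1:] * [:e7, 1:] * [:e8, 1:]"
      by (rule poly_ext) (simp add: se_T0_def poly_pcompose e_def algebra_simps)
    thus ?thesis
      by (simp only: euler_poly_mult euler_poly_X)
  qed
  have T2: "(\<theta> + const_op (2 - e1)) * (\<theta> + const_op (2 - e2))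
      = euler_poly (pcompose (se_T2 a c g) [:u, 1:])"
  proof -
    have "pcompose (se_T2 a c g) [:u, 1:] = [:2 - e1, 1:] * [:2 - e2, 1:]"
      by (rule poly_ext) (simp add: se_T2_def poly_pcompose e_def algebra_simps)
    thus ?thesis
      by (simp only: euler_poly_mult euler_poly_X)
  qed
  have T1: "- 2 * \<theta> ^ 3 + const_op (s11 - s13 - 5) * \<theta> ^ 2
      + const_op (3 * s11 - s21 + s22 - s23 - 8) * \<theta> + const_op (E4_T10 e1 e2 e3 e4 e5 e6 e7 e8)
      = euler_poly (pcompose (se_T1 a b c g) [:u, 1:])"
  proof -
    have "pcompose (se_T1 a b c g) [:u, 1:] = [:E4_T10 e1 e2 e3 e4 e5 e6 e7 e8,
        3 * s11 - s21 + s22 - s23 - 8, s11 - s13 - 5, - 2:]"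
    proof (rule poly_ext)
      fix t
      \<comment> \<open>The factor 54 clears the denominator of \<open>E4_T10\<close>, leaving an
        identity of polynomials.\<close>
      have "54 * E4_T10 e1 e2 e3 e4 e5 e6 e7 e8
          = 54 * (poly (se_T1 a b c g) (t + u) - (t * (3 * s11 - s21 + s22 - s23 - 8)
            + t^2 * (s11 - s13 - 5) - 2 * t^3))"
        unfolding E4_T10_def Let_def s_def e_def se_T1_def by simp algebra
      hence "E4_T10 e1 e2 e3 e4 e5 e6 e7 e8 = poly (se_T1 a b c g) (t + u)
          - (t * (3 * s11 - s21 + s22 - s23 - 8) + t^2 * (s11 - s13 - 5) - 2 * t^3)"
        by (subst (asm) mult_left_cancel) simp_all
      thus "poly (pcompose (se_T1 a b c g) [:u, 1:]) t
          = poly [:E4_T10 e1 e2 e3 e4 e5 e6 e7 e8, 3 * s11 - s21 + s22 - s23 - 8, s11 - s13 - 5, - 2:] t"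
        by (simp add: poly_pcompose algebra_simps power2_eq_square power3_eq_cube)
    qed
    moreover have "euler_poly [:c0, c1, c2, - 2:] = - 2 * \<theta> ^ 3 + const_op c2 * \<theta> ^ 2
        + const_op c1 * \<theta> + const_op c0" for c0 c1 c2
    proof -
      have "euler_poly [:c0, c1, c2, c3:] = const_op c3 * \<theta> ^ 3 + const_op c2 * \<theta> ^ 2
          + const_op c1 * \<theta> + const_op c0" for c3
        by (simp add: euler_poly_pCons distrib_left power2_eq_square power3_eq_cube add_ac
            const_op_commute mult.assoc)
      moreover have "const_op (- 2) = - 2"
        using const_op_add[of "- 2" 2] const_op_add[of 1 1] by (simp add: eq_neg_iff_add_eq_0)
      ultimately show ?thesis by metis
    qed
    ultimately show ?thesis by simp
  qed
  have "SE4 (a, b, c, g, u) = E4 e1 e2 e3 e4 e5 e6 e7 e8"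
    by (simp add: e_def)
  also have "\<dots> = weyl_op u (se_T0 a b c g) (se_T1 a b c g) (se_T2 a c g)"
    unfolding E4_def Let_def weyl_op_def T0[symmetric] T1[symmetric] T2[symmetric] s_def by simp
  finally show ?thesis .
qed

lemmas se_T_defs = se_T0_def se_T1_def se_T2_def

text \<open>
  The coefficients of these operators, and the quotients in the identities below, come from solving
  the linear systems for operators \<open>\<Sum>\<^sub>k p\<^sub>k(s) \<partial>\<^sup>k\<close> with \<open>deg p\<^sub>k \<le> 3 - k\<close>; the solutions are unique up
  to scalars. \<open>se_up_a\<close> and \<open>se_up_b\<close> also raise \<open>u\<close> by 2: without this there is no solution of so small
  a degree.
\<close>

definition se_down_a :: "complex \<Rightarrow> complex \<Rightarrow> complex \<Rightarrow> complex \<Rightarrow> complex \<Rightarrow> diffop" where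
  "se_down_a a b c g u = weyl_op u
    ([:- a - b - 2*c - g - 1, 1:] * [:- 2 - g - 2*c - 2*b - 2*a, 1:] * [:g + 2*a + 1, 1:])
    [:g^2 + c*g - 2*c^2 + b*g - 2*b*c + 4*a*g + 2*a*c + 2*a*b + 4*a^2 + 3*g + 3*c + 3*b + 6*a + 2,
      g + 5*c + 3*b + 2*a, - 2:]
    [:1 - a - c, 1:]"

definition se_up_a :: "complex \<Rightarrow> complex \<Rightarrow> complex \<Rightarrow> complex \<Rightarrow> complex \<Rightarrow> diffop" where
  "se_up_a a b c g u = weyl_op u
    ([:1, 1:] * [:- a - b - 2*c - g - 1, 1:] * [:- 2*c, 1:])
    [:- c*g - 2*c^2 - 2*a*c + g + c + 2*a + 1, g + 3*c + 2*a, - 1:] 0"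

definition se_down_b :: "complex \<Rightarrow> complex \<Rightarrow> complex \<Rightarrow> complex \<Rightarrow> complex \<Rightarrow> diffop" where
  "se_down_b a b c g u = weyl_op u
    ([:- a - b - 2*c - g - 1, 1:] * [:- 2 - g - 2*c - 2*b - 2*a, 1:] * [:g + 2*b + 1, 1:])
    (- ([:- a - c, 1:] * [:- g - 2*c - 2*a - 1, 1:])) 0"

definition se_up_b :: "complex \<Rightarrow> complex \<Rightarrow> complex \<Rightarrow> complex \<Rightarrow> complex \<Rightarrow> diffop" where
  "se_up_b a b c g u = weyl_op u
    ([:1, 1:] * [:- a - b - 2*c - g - 1, 1:] * [:- 2*c, 1:])
    [:- c*g - 2*c^2 - 2*a*c + g + 5*c + 2*a - 1, g + 5*c + 2*a - 3, - 2:]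
    [:2 - a + b - c, 1:]"

section \<open>Intertwining relations of the explicit operators, and their products modulo
  \<open>SE4\<close>\<close>

lemma SE4_down_a: "SE4 (a - 1, b, c, g, u) * se_down_a a b c g u \<in> left_ideal (SE4 (a, b, c, g, u))"
proof -
  \<comment> \<open>Writing \<open>u + 0\<close> lets the offsets of
    \<open>weyl_op_mult_eq_0\<close> unify with 0.\<close>
  have "SE4 (a - 1, b, c, g, u + 0) * se_down_a a b c g (u + 0) = weyl_op (u + 0)
    ([:- a - b - 2*c - g, 1:] * [:- g - 2*c - 2*b - 2*a, 1:] * [:g + 2*a + 1, 1:])
    [:g^2 + c*g - 2*c^2 + b*g - 2*b*c + 4*a*g + 2*a*c + 2*a*b + 4*a^2 + 2*g + 6*c + 4*b + 4*a - 2,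
      g + 5*c + 3*b + 2*a - 4, - 2:]
    [:2 - a - c, 1:] * SE4 (a, b, c, g, u + 0)"
    unfolding SE4_eq_weyl_op se_down_a_def
    by (rule weyl_op_mult_eq_0; simp add: se_T_defs; algebra)
  thus ?thesis unfolding left_ideal_def by auto
qed

lemma SE4_up_a: "SE4 (a + 1, b, c, g, u + 2) * se_up_a a b c g u \<in> left_ideal (SE4 (a, b, c, g, u))"
proof -
  have "SE4 (a + 1, b, c, g, u + 2) * se_up_a a b c g (u + 0) = weyl_op (u + 0)
    ([:3, 1:] * [:- a - b - 2*c - g, 1:] * [:2 - 2*c, 1:])
    [:- c*g - 2*c^2 - 2*a*c + 3*g + 6*c + 6*a, g + 3*c + 2*a - 3, - 1:] 0
    * SE4 (a, b, c, g, u + 0)"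
    unfolding SE4_eq_weyl_op se_up_a_def
    by (rule weyl_op_mult_eq_0; simp add: se_T_defs; algebra)
  thus ?thesis unfolding left_ideal_def by auto
qed

lemma SE4_down_b: "SE4 (a, b - 1, c, g, u) * se_down_b a b c g u \<in> left_ideal (SE4 (a, b, c, g, u))"
proof -
  have "SE4 (a, b - 1, c, g, u + 0) * se_down_b a b c g (u + 0) = weyl_op (u + 0)
    ([:- a - b - 2*c - g, 1:] * [:- g - 2*c - 2*b - 2*a, 1:] * [:g + 2*b + 1, 1:])
    [:- c*g - 2*c^2 - a*g - 4*a*c - 2*a^2 + g + 2*c + 2*a, g + 3*c + 3*a - 1, - 1:] 0
    * SE4 (a, b, c, g, u + 0)"
    unfolding SE4_eq_weyl_op se_down_b_def
    by (rule weyl_op_mult_eq_0; simp add: se_T_defs; algebra)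
  thus ?thesis unfolding left_ideal_def by auto
qed

lemma SE4_up_b: "SE4 (a, b + 1, c, g, u + 2) * se_up_b a b c g u \<in> left_ideal (SE4 (a, b, c, g, u))"
proof -
  have "SE4 (a, b + 1, c, g, u + 2) * se_up_b a b c g (u + 0) = weyl_op (u + 0)
    ([:3, 1:] * [:- a - b - 2*c - g, 1:] * [:2 - 2*c, 1:])
    [:- c*g - 2*c^2 - 2*a*c + 3*g + 14*c + 6*a - 12, g + 5*c + 2*a - 10, - 2:]
    [:4 - a + b - c, 1:] * SE4 (a, b, c, g, u + 0)"
    unfolding SE4_eq_weyl_op se_up_b_def
    by (rule weyl_op_mult_eq_0; simp add: se_T_defs; algebra)
  thus ?thesis unfolding left_ideal_def by auto
qed

text \<open>Lowering a and then raising it has the net effect of u \<rightarrow> u + 2, as does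
  \<partial>^2. The scalar relating the two supplies the genericity conditions on a, b, c,
  g.\<close>

lemma se_up_down_a:
  "se_up_a (a - 1) b c g u * se_down_a a b c g u
    - const_op (a * (2*a + g) * (2*a + 2*c + g + 1) * (a + b + c + g + 1)) * \<partial> ^ 2
    \<in> left_ideal (SE4 (a, b, c, g, u))"
proof -
  have "se_up_a (a - 1) b c g (u + 0) * se_down_a a b c g (u + 0)
    = const_op (a * (2*a + g) * (2*a + 2*c + g + 1) * (a + b + c + g + 1)) * \<partial> ^ 2
    + weyl_op (u + 0) [:- (g^2) - 2*c*g - b*g - 3*a*g - 4*a*c - 2*a*b - 2*a^2 - g - 2*c - b - a,
      - 2*c - b + a + 1, 1:] [:c - 1, - 1:] 0 * SE4 (a, b, c, g, u + 0)"
    unfolding SE4_eq_weyl_op se_up_a_def se_down_a_def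
    by (rule weyl_op_mult_eq; simp add: se_T_defs; algebra)
  thus ?thesis unfolding left_ideal_def by auto
qed

text \<open>The opposite order. Its scalar is that of \<open>se_up_down_a\<close> with a + 1 in
  place of a, so both agree when this lemma is used at a - 1.\<close>

lemma se_down_up_a:
  "se_down_a (a + 1) b c g (u + 2) * se_up_a a b c g u
    - const_op ((a + 1) * (2*a + g + 2) * (2*a + 2*c + g + 3) * (a + b + c + g + 2)) * \<partial> ^ 2
    \<in> left_ideal (SE4 (a, b, c, g, u))"
proof -
  have "se_down_a (a + 1) b c g (u + 2) * se_up_a a b c g (u + 0)
    = const_op ((a + 1) * (2*a + g + 2) * (2*a + 2*c + g + 3) * (a + b + c + g + 2)) * \<partial> ^ 2
    + weyl_op (u + 0) [:- (g^2) - 2*c*g - b*g - 3*a*g - 4*a*c - 2*a*b - 2*a^2 - 5*g - 10*c - 5*b - 5*a,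
      - 2*c - b + a + 5, 1:] [:c - 3, - 1:] 0 * SE4 (a, b, c, g, u + 0)"
    unfolding SE4_eq_weyl_op se_up_a_def se_down_a_def
    by (rule weyl_op_mult_eq; simp add: se_T_defs; algebra)
  thus ?thesis unfolding left_ideal_def by auto
qed

lemma se_up_down_b:
  "se_up_b a (b - 1) c g u * se_down_b a b c g u
    - const_op (b * (2*b + g) * (2*b + 2*c + g + 1) * (a + b + c + g + 1)) * \<partial> ^ 2
    \<in> left_ideal (SE4 (a, b, c, g, u))"
proof -
  have "se_up_b a (b - 1) c g (u + 0) * se_down_b a b c g (u + 0)
    = const_op (b * (2*b + g) * (2*b + 2*c + g + 1) * (a + b + c + g + 1)) * \<partial> ^ 2
    + weyl_op (u + 0) [:- (g^2) - 2*c*g - 3*b*g - 4*b*c - 2*b^2 - a*g - 2*a*b - g - 2*c - b - a,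
      - 2*c + b - a + 1, 1:] [:c - b + a - 1, - 1:] 0 * SE4 (a, b, c, g, u + 0)"
    unfolding SE4_eq_weyl_op se_up_b_def se_down_b_def
    by (rule weyl_op_mult_eq; simp add: se_T_defs; algebra)
  thus ?thesis unfolding left_ideal_def by auto
qed

lemma se_down_up_b:
  "se_down_b a (b + 1) c g (u + 2) * se_up_b a b c g u
    - const_op ((b + 1) * (2*b + g + 2) * (2*b + 2*c + g + 3) * (a + b + c + g + 2)) * \<partial> ^ 2
    \<in> left_ideal (SE4 (a, b, c, g, u))"
proof -
  have "se_down_b a (b + 1) c g (u + 2) * se_up_b a b c g (u + 0)
    = const_op ((b + 1) * (2*b + g + 2) * (2*b + 2*c + g + 3) * (a + b + c + g + 2)) * \<partial> ^ 2
    + weyl_op (u + 0) [:- (g^2) - 2*c*g - 3*b*g - 4*b*c - 2*b^2 - a*g - 2*a*b - 5*g - 10*c - 5*b - 5*a,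
      - 2*c + b - a + 5, 1:] [:c - b + a - 3, - 1:] 0 * SE4 (a, b, c, g, u + 0)"
    unfolding SE4_eq_weyl_op se_up_b_def se_down_b_def
    by (rule weyl_op_mult_eq; simp add: se_T_defs; algebra)
  thus ?thesis unfolding left_ideal_def by auto
qed

section \<open>Order and leading coefficient of \<open>SE4\<close>\<close>

text \<open>All three summands of \<open>E4\<close> reach order 4 and contribute x^4, -2 x^3 and
  x^2. The sum x^2 (x - 1)^2 is nonzero for every choice of parameters.\<close>

lemma order_le_SE4: "order_le 4 (to_fract [:0, 0, 1, - 2, 1:]) (SE4 x)"
proof -
  obtain a b c g u where x: "x = (a, b, c, g, u)"
    by (rule prod_cases5)
  let ?X = "to_fract [:0, 1:] :: ratfun"
  have const: "order_le 1 0 (const_op k)" for k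
    using order_le_weaken[OF order_le_mult_op] by auto
  have lin: "order_le 1 ?X (\<theta> + const_op k)" for k
    using order_le_add[OF order_le_euler const] by simp
  have pow: "order_le 2 (?X * ?X) (\<theta> ^ 2)" "order_le 3 (?X * (?X * ?X)) (\<theta> ^ 3)"
    using order_le_mult[OF order_le_euler order_le_euler]
      order_le_mult[OF order_le_euler order_le_mult[OF order_le_euler order_le_euler]]
    by (simp_all add: power2_eq_square power3_eq_cube numeral_2_eq_2 numeral_3_eq_3 mult.assoc)
  have lower: "order_le 3 0 (const_op k * \<theta> ^ 2)" "order_le 3 0 (const_op k * \<theta>)"
    "order_le 3 0 (const_op k)" for k
    using order_le_weaken[OF order_le_mult[OF order_le_mult_op pow(1)], of 3]
      order_le_weaken[OF order_le_mult[OF order_le_mult_op order_le_euler], of 3]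
      order_le_weaken[OF order_le_mult_op, of 3]
    by auto
  have "order_le 3 (- 2 * (?X * (?X * ?X))) (- 2 * \<theta> ^ 3)"
  proof -
    have "order_le 3 (0 - ?X * (?X * ?X) - ?X * (?X * ?X)) (0 - \<theta> ^ 3 - \<theta> ^ 3)"
      by (intro order_le_diff pow) (simp add: order_le_def coeffs_of_simps)
    moreover have "0 - \<theta> ^ 3 - \<theta> ^ 3 = - 2 * \<theta> ^ 3"
      by (simp add: mult_2)
    moreover have "0 - ?X * (?X * ?X) - ?X * (?X * ?X) = - 2 * (?X * (?X * ?X))"
      by simp
    ultimately show ?thesis by metis
  qed
  from order_le_mult[OF order_le_add[OF order_le_add[OF order_le_add[OF this lower(1)] lower(2)]
      lower(3)] order_le_dx]
  have T1: "order_le 4 (- 2 * (?X * (?X * ?X)))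
      ((- 2 * \<theta> ^ 3 + const_op k2 * \<theta> ^ 2 + const_op k1 * \<theta> + const_op k0) * \<partial>)" for k2 k1 k0
    by (simp only: add_0_right mult_1_right) (simp add: numeral_eq_Suc)
  from order_le_mult[OF order_le_mult[OF order_le_mult[OF lin lin] lin] lin]
  have T0: "order_le 4 (?X * ?X * ?X * ?X)
      ((\<theta> + const_op k5) * (\<theta> + const_op k6) * (\<theta> + const_op k7) * (\<theta> + const_op k8))" for k5 k6 k7 k8
    by (simp only: numeral_eq_Suc) (simp add: numeral_eq_Suc)
  from order_le_mult[OF order_le_mult[OF lin lin] order_le_dx_power[of 2]]
  have T2: "order_le 4 (?X * ?X) ((\<theta> + const_op k1) * (\<theta> + const_op k2) * \<partial> ^ 2)" for k1 k2
    by (simp add: numeral_eq_Suc)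
  have "order_le 4 (?X * ?X * ?X * ?X + - 2 * (?X * (?X * ?X)) + ?X * ?X) (SE4 x)"
    unfolding x SE4.simps E4_def Let_def
    by (intro order_le_add T0 T1 T2)
  moreover have "?X * ?X * ?X * ?X + - 2 * (?X * (?X * ?X)) + ?X * ?X = to_fract [:0, 0, 1, - 2, 1:]"
  proof -
    have "?X * ?X * ?X * ?X + - 2 * (?X * (?X * ?X)) + ?X * ?X
        = ?X * ?X * ?X * ?X - ?X * (?X * ?X) - ?X * (?X * ?X) + ?X * ?X"
      by simp
    also have "\<dots> = to_fract [:0, 0, 1, - 2, 1:]"
      by (simp only: to_fract_mult[symmetric] to_fract_diff[symmetric] to_fract_add[symmetric]) simp
    finally show ?thesis .
  qed
  ultimately show ?thesis by simp
qed

section \<open>The derivation as an isomorphism for the shift of u\<close>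

lemma op_comp_pCons_0: "op_comp P (pCons 0 Q) = pCons 0 (op_comp P Q)"
  by (induction P arbitrary: Q rule: pCons_induct)
    (simp_all add: op_comp_pCons deriv_comp_pCons, simp add: deriv_comp_def)

text \<open>With coefficients written on the left, right multiplication by \<partial> merely moves
  them up one place.\<close>

lemma dx_cancel_right: "A * \<partial> = B * \<partial> \<Longrightarrow> A = B"
proof -
  assume "A * \<partial> = B * \<partial>"
  hence "op_comp (coeffs_of A) [:0, 1:] = op_comp (coeffs_of B) [:0, 1:]"
    by (metis coeffs_of_simps(5) dx_def Diffop_inverse UNIV_I)
  moreover have "op_comp R [:0, 1:] = pCons 0 R" for R
    using op_comp_pCons_0[of R 1] by (simp add: op_comp_1_right one_pCons[symmetric])
  ultimately show "A = B"
    by (simp add: coeffs_of_inject)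
qed

text \<open>Moving \<partial> to the right replaces \<theta> by \<theta> + 1, which is the same as
  replacing u by u + 1.\<close>

lemma dx_weyl_op: "\<partial> * weyl_op u f0 f1 f2 = weyl_op (u + 1) f0 f1 f2 * \<partial>"
proof -
  have "\<partial> * euler_poly (pcompose f [:u, 1:]) = euler_poly (pcompose f [:u + 1, 1:]) * \<partial>" for f
    by (simp add: dx_euler_poly pcompose_assoc[symmetric] pcompose_pCons add.commute)
  hence "\<partial> * (euler_poly (pcompose f [:u, 1:]) * B) = euler_poly (pcompose f [:u + 1, 1:]) * (\<partial> * B)"
    for f B
    by (metis mult.assoc)
  with this[of _ 1] show ?thesis
    by (simp add: weyl_op_def distrib_left distrib_right power2_eq_square mult.assoc)
qed

text \<open>Since \<theta> = x \<partial>, only the value of the first coefficient at \<theta> = 0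
  survives modulo left multiples of \<partial>. For \<open>SE4\<close> this is the product of the
  exponents \<open>e\<^sub>5\<close> to \<open>e\<^sub>8\<close>.\<close>

lemma weyl_op_mod_dx: "\<exists>A. weyl_op u f0 f1 f2 = A * \<partial> + const_op (poly f0 u)"
proof -
  have "\<exists>B. euler_poly p = B * \<partial> + const_op (poly p 0)" for p
  proof (cases p)
    case (pCons c q)
    have "\<theta> * euler_poly q = euler_poly [:0, 1:] * euler_poly q"
      by (simp add: euler_poly_pCons one_pCons[symmetric])
    also have "\<dots> = euler_poly q * \<theta>"
      by (metis euler_poly_mult mult.commute euler_poly_X add.right_neutral const_op_0)
    finally have "euler_poly p = euler_poly q * mult_op (to_fract [:0, 1:]) * \<partial> + const_op (poly p 0)"
      by (simp add: pCons euler_poly_pCons euler_op_def mult.assoc)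
    thus ?thesis by blast
  qed
  from this[of "pcompose f0 [:u, 1:]"]
  obtain B where "euler_poly (pcompose f0 [:u, 1:]) = B * \<partial> + const_op (poly f0 u)"
    by (auto simp: poly_pcompose)
  thus ?thesis
    by (intro exI[of _ "B + euler_poly (pcompose f1 [:u, 1:]) + euler_poly (pcompose f2 [:u, 1:]) * \<partial>"])
      (simp add: weyl_op_def distrib_right power2_eq_square mult.assoc add_ac)
qed

text \<open>With E = A \<partial> + k, cancelling \<partial> in F \<partial> = \<partial> E gives F
  = \<partial> A + k. Hence -A / k inverts \<partial> modulo both operators, and E A = A F makes it
  an intertwiner.\<close>

lemma inverse_pair_dx:
  assumes "poly f0 u \<noteq> 0"
  shows "\<exists>P'. inverse_pair (weyl_op u f0 f1 f2) (weyl_op (u + 1) f0 f1 f2) \<partial> P'"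
proof -
  define E F k where "E = weyl_op u f0 f1 f2" "F = weyl_op (u + 1) f0 f1 f2" "k = poly f0 u"
  obtain A where A: "E = A * \<partial> + const_op k"
    using weyl_op_mod_dx E_F_k_def by metis
  have dE: "\<partial> * E = F * \<partial>"
    by (simp add: E_F_k_def dx_weyl_op)
  have "F * \<partial> = (\<partial> * A + const_op k) * \<partial>"
    using dE by (simp add: A distrib_left distrib_right mult.assoc const_op_commute)
  hence F: "F = \<partial> * A + const_op k"
    by (rule dx_cancel_right)
  have EA: "E * A = A * F"
    by (simp add: A F distrib_left distrib_right mult.assoc const_op_commute)
  have k: "const_op (1 / k) * const_op k = 1"
    using assms by (simp add: E_F_k_def flip: const_op_mult)
  have "- const_op (1 / k) * A * \<partial> - 1 = - const_op (1 / k) * E"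
    by (simp add: A distrib_left mult.assoc k)
  moreover have "\<partial> * (- const_op (1 / k) * A) - 1 = - const_op (1 / k) * F"
    by (simp add: F distrib_left k) (metis const_op_commute mult.assoc)
  moreover have "E * (- const_op (1 / k) * A) = - const_op (1 / k) * A * F"
    using EA by simp (metis const_op_commute mult.assoc)
  ultimately have "inverse_pair E F \<partial> (- const_op (1 / k) * A)"
    unfolding inverse_pair_def left_ideal_def using dE[symmetric] by blast
  thus ?thesis
    unfolding E_F_k_def by blast
qed

lemma inverse_pair_dx2:
  assumes "poly (se_T0 a b c g) u \<noteq> 0" "poly (se_T0 a b c g) (u + 1) \<noteq> 0" "k \<noteq> 0"
  shows "\<exists>P'. inverse_pair (SE4 (a, b, c, g, u)) (SE4 (a, b, c, g, u + 2)) (const_op k * \<partial> ^ 2) P'"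
proof -
  obtain P1 P2 where
    "inverse_pair (SE4 (a, b, c, g, u)) (SE4 (a, b, c, g, u + 1)) \<partial> P1"
    "inverse_pair (SE4 (a, b, c, g, u + 1)) (SE4 (a, b, c, g, u + 1 + 1)) \<partial> P2"
    using inverse_pair_dx[OF assms(1)] inverse_pair_dx[OF assms(2)] unfolding SE4_eq_weyl_op by blast
  from inverse_pair_scale[OF inverse_pair_comp[OF this] assms(3)] show ?thesis
    by (auto simp: power2_eq_square add.assoc)
qed

text \<open>Lowering, raising and lowering again give two overlapping composites, both equal to
  \<open>?k\<close> times \<partial>^2 modulo the respective operator. The conditions on
  \<open>se_T0\<close> make \<partial>^2 invertible at a and at a - 1.\<close>

lemma equivalent_SE4_a:
  assumes nz: "a * (2*a + g) * (2*a + 2*c + g + 1) * (a + b + c + g + 1) \<noteq> 0" (is "?k \<noteq> 0")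
    and "poly (se_T0 a b c g) u \<noteq> 0" "poly (se_T0 a b c g) (u + 1) \<noteq> 0"
    and "poly (se_T0 (a - 1) b c g) u \<noteq> 0" "poly (se_T0 (a - 1) b c g) (u + 1) \<noteq> 0"
  shows "equivalent_op (SE4 (a, b, c, g, u)) (SE4 (a - 1, b, c, g, u))"
proof -
  obtain U' where U: "inverse_pair (SE4 (a, b, c, g, u)) (SE4 (a, b, c, g, u + 2)) (const_op ?k * \<partial> ^ 2) U'"
    using inverse_pair_dx2[OF assms(2,3) nz] by blast
  obtain V' where V: "inverse_pair (SE4 (a - 1, b, c, g, u)) (SE4 (a - 1, b, c, g, u + 2))
      (const_op ?k * \<partial> ^ 2) V'"
    using inverse_pair_dx2[OF assms(4,5) nz] by blast
  have "2 * (a - 1) + g + 2 = 2*a + g" "2 * (a - 1) + 2*c + g + 3 = 2*a + 2*c + g + 1"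
    "a - 1 + b + c + g + 2 = a + b + c + g + 1"
    by simp_all
  note k = this
  show ?thesis
    by (rule equivalent_op_two_out_of_six[OF SE4_down_a _ U V se_up_down_a])
      (use SE4_up_a[of "a - 1" b c g u] se_down_up_a[of "a - 1" b c g u] in \<open>simp_all only: k diff_add_cancel\<close>)
qed

lemma equivalent_SE4_b:
  assumes nz: "b * (2*b + g) * (2*b + 2*c + g + 1) * (a + b + c + g + 1) \<noteq> 0" (is "?k \<noteq> 0")
    and "poly (se_T0 a b c g) u \<noteq> 0" "poly (se_T0 a b c g) (u + 1) \<noteq> 0"
    and "poly (se_T0 a (b - 1) c g) u \<noteq> 0" "poly (se_T0 a (b - 1) c g) (u + 1) \<noteq> 0"
  shows "equivalent_op (SE4 (a, b, c, g, u)) (SE4 (a, b - 1, c, g, u))"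
proof -
  obtain U' where U: "inverse_pair (SE4 (a, b, c, g, u)) (SE4 (a, b, c, g, u + 2)) (const_op ?k * \<partial> ^ 2) U'"
    using inverse_pair_dx2[OF assms(2,3) nz] by blast
  obtain V' where V: "inverse_pair (SE4 (a, b - 1, c, g, u)) (SE4 (a, b - 1, c, g, u + 2))
      (const_op ?k * \<partial> ^ 2) V'"
    using inverse_pair_dx2[OF assms(4,5) nz] by blast
  have "2 * (b - 1) + g + 2 = 2*b + g" "2 * (b - 1) + 2*c + g + 3 = 2*b + 2*c + g + 1"
    "a + (b - 1) + c + g + 2 = a + b + c + g + 1"
    by simp_all
  note k = this
  show ?thesis
    by (rule equivalent_op_two_out_of_six[OF SE4_down_b _ U V se_up_down_b])
      (use SE4_up_b[of a "b - 1" c g u] se_down_up_b[of a "b - 1" c g u] in \<open>simp_all only: k diff_add_cancel\<close>)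
qed

section \<open>Symmetries\<close>

text \<open>The affine involution that exchanges \<open>e\<^sub>5\<close> and
  \<open>e\<^sub>7\<close> and fixes the other six exponents.\<close>

definition swap57 :: "params \<Rightarrow> params" where
  "swap57 = (\<lambda>(a, b, c, g, u). (a, b, - c - 1, g + 2*c + 1, u - 2*c - 1))"

text \<open>Likewise for \<open>e\<^sub>7\<close> and \<open>e\<^sub>8\<close>.\<close>

definition swap78 :: "params \<Rightarrow> params" where
  "swap78 = (\<lambda>(a, b, c, g, u). (- b - 1 - g/2, - a - 1 - g/2, a + b + c + 1 + g/2, g, u))"

lemma weyl_op_cong:
  assumes "\<And>t. poly f0 (t + u) = poly g0 (t + v)" "\<And>t. poly f1 (t + u) = poly g1 (t + v)"
    "\<And>t. poly f2 (t + u) = poly g2 (t + v)"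
  shows "weyl_op u f0 f1 f2 = weyl_op v g0 g1 g2"
proof -
  have "pcompose p [:u, 1:] = pcompose q [:v, 1:]" if "\<And>t. poly p (t + u) = poly q (t + v)" for p q
    using that by (simp add: poly_eq_poly_eq_iff[symmetric] fun_eq_iff poly_pcompose add.commute)
  from this[OF assms(1)] this[OF assms(2)] this[OF assms(3)] show ?thesis
    by (simp add: weyl_op_def)
qed

lemma SE4_swap57: "SE4 (swap57 x) = SE4 x"
proof -
  obtain a b c g u where x: "x = (a, b, c, g, u)"
    by (rule prod_cases5)
  show ?thesis
    unfolding x swap57_def prod.case SE4_eq_weyl_op
    by (rule weyl_op_cong; simp add: se_T_defs; algebra)
qed

lemma SE4_swap78: "SE4 (swap78 x) = SE4 x"
proof -
  obtain a b c h u where "x = (a, b, c, h, u)"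
    by (rule prod_cases5)
  \<comment> \<open>Halving the fourth parameter beforehand removes the fractions from
    \<open>swap78\<close>, as \<open>algebra\<close> prefers.\<close>
  then obtain g where x: "x = (a, b, c, 2 * g, u)"
    using that[of "h / 2"] by simp
  show ?thesis
    unfolding x swap78_def prod.case SE4_eq_weyl_op
    by (rule weyl_op_cong; simp add: se_T_defs; algebra)
qed

section \<open>Generic parameters\<close>

definition affine_fun :: "(params \<Rightarrow> complex) \<Rightarrow> bool" where
  "affine_fun f \<longleftrightarrow> (\<exists>k0 k1 k2 k3 k4 k5. \<forall>a b c g u.
    f (a, b, c, g, u) = k0 + k1 * a + k2 * b + k3 * c + k4 * g + k5 * u)"

lemma affine_funI:
  "(\<And>a b c g u. f (a, b, c, g, u) = k0 + k1 * a + k2 * b + k3 * c + k4 * g + k5 * u) \<Longrightarrow> affine_fun f"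
  unfolding affine_fun_def by blast

text \<open>
  A form of genericity for which stability under affine changes of the parameters is immediate.
\<close>

inductive hyperplane_generic :: "(params \<Rightarrow> bool) \<Rightarrow> bool" where
  affine: "affine_fun f \<Longrightarrow> f x \<noteq> 0 \<Longrightarrow> hyperplane_generic (\<lambda>y. f y \<noteq> 0)"
| conj: "hyperplane_generic R \<Longrightarrow> hyperplane_generic S \<Longrightarrow> hyperplane_generic (\<lambda>y. R y \<and> S y)"
| mono: "hyperplane_generic R \<Longrightarrow> (\<And>y. R y \<Longrightarrow> S y) \<Longrightarrow> hyperplane_generic S"

lemma eval_params_mult: "eval_params (F * G) x = eval_params F x * eval_params G x"
  by (cases x) simp

lemma affine_fun_eval_params:
  assumes "affine_fun f"
  obtains F where "\<And>x. eval_params F x = f x"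
proof -
  obtain k0 k1 k2 k3 k4 k5 where
    f: "\<And>a b c g u. f (a, b, c, g, u) = k0 + k1 * a + k2 * b + k3 * c + k4 * g + k5 * u"
    using assms by (auto simp: affine_fun_def)
  \<comment> \<open>The outermost polynomial variable is a and the innermost is u.\<close>
  have "eval_params [:[:[:[:[:k0, k5:], [:k4:]:], [:[:k3:]:]:], [:[:[:k2:]:]:]:], [:[:[:[:k1:]:]:]:]:] x = f x" for x
    by (cases x) (simp add: f algebra_simps)
  thus ?thesis by (rule that)
qed

lemma hyperplane_generic_imp_generically: "hyperplane_generic R \<Longrightarrow> generically R"
proof (induction rule: hyperplane_generic.induct)
  case (affine f x)
  obtain F where F: "\<And>x. eval_params F x = f x"
    using affine_fun_eval_params affine(1) by blast
  have "eval_params 0 x = 0"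
    by (cases x) simp
  hence "F \<noteq> 0"
    using F affine(2) by metis
  thus ?case
    unfolding generically_def using F by metis
next
  case (conj R S)
  then obtain F G where "F \<noteq> 0" "\<And>x. eval_params F x \<noteq> 0 \<Longrightarrow> R x"
    "G \<noteq> 0" "\<And>x. eval_params G x \<noteq> 0 \<Longrightarrow> S x"
    unfolding generically_def by blast
  thus ?case
    unfolding generically_def by (intro exI[of _ "F * G"]) (simp add: eval_params_mult)
next
  case (mono R S)
  thus ?case
    unfolding generically_def by blast
qed

text \<open>Affinity is expressed by pulling back affine functions; surjectivity keeps a pullback
  from vanishing identically.\<close>

definition affine_bij :: "(params \<Rightarrow> params) \<Rightarrow> bool" where
  "affine_bij \<tau> \<longleftrightarrow> surj \<tau> \<and> (\<forall>f. affine_fun f \<longrightarrow> affine_fun (\<lambda>x. f (\<tau> x)))"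

lemma hyperplane_generic_precomp:
  assumes "hyperplane_generic R" "affine_bij \<tau>"
  shows "hyperplane_generic (\<lambda>x. R (\<tau> x))"
  using assms(1)
proof (induction rule: hyperplane_generic.induct)
  case (affine f x)
  obtain y where "x = \<tau> y"
    using assms(2) unfolding affine_bij_def by (metis surjD)
  thus ?case
    using hyperplane_generic.affine[of "\<lambda>x. f (\<tau> x)" y] affine assms(2) by (simp add: affine_bij_def)
next
  case (conj R S)
  thus ?case by (intro hyperplane_generic.conj)
next
  case (mono R S)
  show ?case
    by (rule hyperplane_generic.mono[OF mono.IH]) (rule mono.hyps(2))
qed

lemma affine_bij_translate: "affine_bij (\<lambda>x. x + d)"
proof -
  obtain d1 d2 d3 d4 d5 where d: "d = (d1, d2, d3, d4, d5)"
    by (rule prod_cases5)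
  have "affine_fun (\<lambda>x. f (x + d))" if f: "affine_fun f" for f
  proof -
    obtain k0 k1 k2 k3 k4 k5 where
      "\<And>a b c g u. f (a, b, c, g, u) = k0 + k1 * a + k2 * b + k3 * c + k4 * g + k5 * u"
      using f by (auto simp: affine_fun_def)
    thus ?thesis
      by (intro affine_funI[of _ "k0 + k1 * d1 + k2 * d2 + k3 * d3 + k4 * d4 + k5 * d5" k1 k2 k3 k4 k5])
        (simp add: d algebra_simps)
  qed
  moreover have "surj (\<lambda>x. x + d)"
    by (rule surjI[of _ "\<lambda>x. x - d"]) simp
  ultimately show ?thesis by (simp add: affine_bij_def)
qed

lemma affine_bij_swap57: "affine_bij swap57"
proof -
  have "affine_fun (\<lambda>x. f (swap57 x))" if f: "affine_fun f" for f
  proof -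
    obtain k0 k1 k2 k3 k4 k5 where
      "\<And>a b c g u. f (a, b, c, g, u) = k0 + k1 * a + k2 * b + k3 * c + k4 * g + k5 * u"
      using f by (auto simp: affine_fun_def)
    thus ?thesis
      by (intro affine_funI[of _ "k0 - k3 + k4 - k5" k1 k2 "- k3 + 2 * k4 - 2 * k5" k4 k5])
        (simp add: swap57_def algebra_simps)
  qed
  moreover have "surj swap57"
    by (rule surjI[of _ swap57]) (auto simp: swap57_def)
  ultimately show ?thesis by (simp add: affine_bij_def)
qed

lemma affine_bij_swap78: "affine_bij swap78"
proof -
  have "affine_fun (\<lambda>x. f (swap78 x))" if f: "affine_fun f" for f
  proof -
    obtain k0 k1 k2 k3 k4 k5 where
      "\<And>a b c g u. f (a, b, c, g, u) = k0 + k1 * a + k2 * b + k3 * c + k4 * g + k5 * u"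
      using f by (auto simp: affine_fun_def)
    thus ?thesis
      by (intro affine_funI[of _ "k0 - k1 - k2 + k3" "- k2 + k3" "- k1 + k3" k3
            "- k1 / 2 - k2 / 2 + k3 / 2 + k4" k5])
        (simp add: swap78_def field_simps)
  qed
  moreover have "surj swap78"
    by (rule surjI[of _ swap78]) (auto simp: swap78_def field_simps)
  ultimately show ?thesis by (simp add: affine_bij_def)
qed

section \<open>Closure of the generic shifts under sums, negatives and symmetries\<close>

definition generic_shift :: "params \<Rightarrow> bool" where
  "generic_shift d \<longleftrightarrow> hyperplane_generic (\<lambda>x. equivalent_op (SE4 x) (SE4 (x + d)))"

text \<open>The second equivalence is taken at the translated point \<open>x + d\<close>;
  translations preserve genericity.\<close>

lemma generic_shift_add:
  assumes "generic_shift d" "generic_shift e"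
  shows "generic_shift (d + e)"
proof -
  have "hyperplane_generic (\<lambda>x. equivalent_op (SE4 (x + d)) (SE4 (x + d + e)))"
    using hyperplane_generic_precomp[OF assms(2)[unfolded generic_shift_def] affine_bij_translate] .
  from hyperplane_generic.conj[OF assms(1)[unfolded generic_shift_def] this] show ?thesis
    unfolding generic_shift_def
    by (rule hyperplane_generic.mono) (metis add.assoc equivalent_op_trans)
qed

lemma generic_shift_uminus:
  assumes "generic_shift d"
  shows "generic_shift (- d)"
  using hyperplane_generic_precomp[OF assms[unfolded generic_shift_def] affine_bij_translate[of "- d"]]
  unfolding generic_shift_def by (rule hyperplane_generic.mono) (simp add: equivalent_op_sym)

text \<open>The equivalence at \<open>\<tau> x\<close> along \<open>d\<close> ends at
  \<open>\<tau> (x + e)\<close>, and \<open>SE4\<close> does not distinguish these points from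
  \<open>x\<close> and \<open>x + e\<close>.\<close>

lemma generic_shift_conjugate:
  assumes "generic_shift d" "affine_bij \<tau>" "\<And>x. SE4 (\<tau> x) = SE4 x" "\<And>x. \<tau> (x + e) = \<tau> x + d"
  shows "generic_shift e"
  using hyperplane_generic_precomp[OF assms(1)[unfolded generic_shift_def] assms(2)]
  unfolding generic_shift_def by (rule hyperplane_generic.mono) (metis assms(3,4))

lemma generic_shift_imp_admits_shift_operator:
  assumes "generic_shift d" "\<And>x. sh x = x + d"
  shows "admits_shift_operator SE4 sh"
proof -
  have "generically (\<lambda>x. equivalent_op (SE4 x) (SE4 (x + d)))"
    using assms(1) hyperplane_generic_imp_generically by (simp add: generic_shift_def)
  moreover have "\<exists>P. is_shift_operator SE4 sh x P" if "equivalent_op (SE4 x) (SE4 (x + d))" for x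
  proof (rule equivalent_op_imp_shift_operator)
    show "equivalent_op (SE4 x) (SE4 (sh x))"
      using that by (simp only: assms(2))
    show "order_le (Suc 3) (to_fract [:0, 0, 1, - 2, 1:]) (SE4 x)"
      using order_le_SE4[of x] by simp
  qed simp
  ultimately show ?thesis
    unfolding admits_shift_operator_def generically_def by blast
qed

lemma hyperplane_generic_linear:
  assumes "k0 \<noteq> 0 \<or> k1 \<noteq> 0 \<or> k2 \<noteq> 0 \<or> k3 \<noteq> 0 \<or> k4 \<noteq> 0 \<or> k5 \<noteq> 0"
  shows "hyperplane_generic (\<lambda>(a, b, c, g, u). k0 + k1 * a + k2 * b + k3 * c + k4 * g + k5 * u \<noteq> 0)"
proof -
  let ?f = "\<lambda>(a, b, c, g, u). k0 + k1 * a + k2 * b + k3 * c + k4 * g + k5 * u"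
  have "affine_fun ?f"
    by (rule affine_funI[of _ k0 k1 k2 k3 k4 k5]) simp
  moreover have "\<exists>x. ?f x \<noteq> 0"
  proof (rule ccontr)
    assume "\<nexists>x. ?f x \<noteq> 0"
    hence "?f (0, 0, 0, 0, 0) = 0" "?f (1, 0, 0, 0, 0) = 0" "?f (0, 1, 0, 0, 0) = 0"
      "?f (0, 0, 1, 0, 0) = 0" "?f (0, 0, 0, 1, 0) = 0" "?f (0, 0, 0, 0, 1) = 0"
      by blast+
    thus False
      using assms by simp
  qed
  ultimately show ?thesis
    using hyperplane_generic.mono[OF hyperplane_generic.affine[of ?f]] by fastforce
qed

section \<open>The generating shifts and the shifts of c and g\<close>

lemma poly_se_T0:
  "poly (se_T0 a b c g) u
    = (u + 1) * (u - a - b - 2*c - g - 1) * (u - 2*c) * (u - 2 - g - 2*c - 2*b - 2*a)"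
  by (simp add: se_T0_def algebra_simps)

definition exponents_nonzero :: "params \<Rightarrow> bool" where
  "exponents_nonzero = (\<lambda>(a, b, c, g, u). poly (se_T0 a b c g) u \<noteq> 0)"

lemma hyperplane_generic_exponents: "hyperplane_generic exponents_nonzero"
proof -
  note lin = hyperplane_generic_linear
  \<comment> \<open>The coefficients 0 and 1 are spelled out so that
    \<open>hyperplane_generic_linear\<close> applies by unification.\<close>
  have "hyperplane_generic (\<lambda>x. (case x of (a, b, c, g, u) \<Rightarrow> 1 + 0 * a + 0 * b + 0 * c + 0 * g + 1 * u \<noteq> 0)
    \<and> (case x of (a, b, c, g, u) \<Rightarrow> - 1 + - 1 * a + - 1 * b + - 2 * c + - 1 * g + 1 * u \<noteq> 0)
    \<and> (case x of (a, b, c, g, u) \<Rightarrow> 0 + 0 * a + 0 * b + - 2 * c + 0 * g + 1 * u \<noteq> 0)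
    \<and> (case x of (a, b, c, g, u) \<Rightarrow> - 2 + - 2 * a + - 2 * b + - 2 * c + - 1 * g + 1 * u \<noteq> 0))"
    by (intro hyperplane_generic.conj hyperplane_generic_linear) simp_all
  thus ?thesis
    by (rule hyperplane_generic.mono)
      (auto simp only: exponents_nonzero_def poly_se_T0 split_paired_all prod.case mult_eq_0_iff de_Morgan_disj,
        simp_all add: algebra_simps)
qed

lemma generic_shift_u: "generic_shift (0, 0, 0, 0, 1)"
  unfolding generic_shift_def
  using hyperplane_generic_exponents
proof (rule hyperplane_generic.mono)
  fix x assume "exponents_nonzero x"
  moreover obtain a b c g u where x: "x = (a, b, c, g, u)"
    by (rule prod_cases5)
  ultimately show "equivalent_op (SE4 x) (SE4 (x + (0, 0, 0, 0, 1)))"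
    using inverse_pair_dx unfolding equivalent_op_def exponents_nonzero_def x
    by (simp add: SE4_eq_weyl_op del: SE4.simps) blast
qed

lemma generic_shift_a: "generic_shift (- 1, 0, 0, 0, 0)"
proof -
  have nz: "hyperplane_generic (\<lambda>x. exponents_nonzero (x + d))" for d
    by (rule hyperplane_generic_precomp[OF hyperplane_generic_exponents affine_bij_translate])
  have "hyperplane_generic (\<lambda>x. (case x of (a, b, c, g, u) \<Rightarrow> 0 + 1 * a + 0 * b + 0 * c + 0 * g + 0 * u \<noteq> 0)
    \<and> (case x of (a, b, c, g, u) \<Rightarrow> 0 + 2 * a + 0 * b + 0 * c + 1 * g + 0 * u \<noteq> 0)
    \<and> (case x of (a, b, c, g, u) \<Rightarrow> 1 + 2 * a + 0 * b + 2 * c + 1 * g + 0 * u \<noteq> 0)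
    \<and> (case x of (a, b, c, g, u) \<Rightarrow> 1 + 1 * a + 1 * b + 1 * c + 1 * g + 0 * u \<noteq> 0)
    \<and> exponents_nonzero x \<and> exponents_nonzero (x + (0, 0, 0, 0, 1))
    \<and> exponents_nonzero (x + (- 1, 0, 0, 0, 0)) \<and> exponents_nonzero (x + (- 1, 0, 0, 0, 1)))"
    by (intro hyperplane_generic.conj hyperplane_generic_linear nz hyperplane_generic_exponents) simp_all
  thus ?thesis
    unfolding generic_shift_def
  proof (rule hyperplane_generic.mono, goal_cases)
    case (1 x)
    obtain a b c g u where x: "x = (a, b, c, g, u)"
      by (rule prod_cases5)
    have "equivalent_op (SE4 (a, b, c, g, u)) (SE4 (a - 1, b, c, g, u))"
      by (rule equivalent_SE4_a) (use 1 in \<open>simp_all add: x exponents_nonzero_def add_ac\<close>)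
    thus ?case by (simp add: x del: SE4.simps)
  qed
qed

lemma generic_shift_b: "generic_shift (0, - 1, 0, 0, 0)"
proof -
  have nz: "hyperplane_generic (\<lambda>x. exponents_nonzero (x + d))" for d
    by (rule hyperplane_generic_precomp[OF hyperplane_generic_exponents affine_bij_translate])
  have "hyperplane_generic (\<lambda>x. (case x of (a, b, c, g, u) \<Rightarrow> 0 + 0 * a + 1 * b + 0 * c + 0 * g + 0 * u \<noteq> 0)
    \<and> (case x of (a, b, c, g, u) \<Rightarrow> 0 + 0 * a + 2 * b + 0 * c + 1 * g + 0 * u \<noteq> 0)
    \<and> (case x of (a, b, c, g, u) \<Rightarrow> 1 + 0 * a + 2 * b + 2 * c + 1 * g + 0 * u \<noteq> 0)
    \<and> (case x of (a, b, c, g, u) \<Rightarrow> 1 + 1 * a + 1 * b + 1 * c + 1 * g + 0 * u \<noteq> 0)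
    \<and> exponents_nonzero x \<and> exponents_nonzero (x + (0, 0, 0, 0, 1))
    \<and> exponents_nonzero (x + (0, - 1, 0, 0, 0)) \<and> exponents_nonzero (x + (0, - 1, 0, 0, 1)))"
    by (intro hyperplane_generic.conj hyperplane_generic_linear nz hyperplane_generic_exponents) simp_all
  thus ?thesis
    unfolding generic_shift_def
  proof (rule hyperplane_generic.mono, goal_cases)
    case (1 x)
    obtain a b c g u where x: "x = (a, b, c, g, u)"
      by (rule prod_cases5)
    have "equivalent_op (SE4 (a, b, c, g, u)) (SE4 (a, b - 1, c, g, u))"
      by (rule equivalent_SE4_b) (use 1 in \<open>simp_all add: x exponents_nonzero_def add_ac\<close>)
    thus ?case by (simp add: x del: SE4.simps)
  qed
qed

text \<open>Raising b and lowering c by 1 lowers the first component of \<open>swap78\<close> by 1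
  and leaves the others unchanged.\<close>

lemma generic_shift_b_c: "generic_shift (0, 1, - 1, 0, 0)"
  by (rule generic_shift_conjugate[OF generic_shift_a affine_bij_swap78 SE4_swap78])
    (auto simp: swap78_def)

text \<open>Under \<open>swap57\<close> this direction becomes (0, 1, -1, 0, 0), because the changes
  of c, g and u cancel in the last two components.\<close>

lemma generic_shift_b_c_g_u: "generic_shift (0, 1, 1, - 2, 2)"
  by (rule generic_shift_conjugate[OF generic_shift_b_c affine_bij_swap57 SE4_swap57])
    (auto simp: swap57_def)

lemma generic_shift_c: "generic_shift (0, 0, - 1, 0, 0)"
  using generic_shift_add[OF generic_shift_b_c generic_shift_b] by simp

lemma generic_shift_g: "generic_shift (0, 0, 0, - 2, 0)"
proof -
  have "generic_shift (0, 0, 0, 0, - 1)"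
    using generic_shift_uminus[OF generic_shift_u] by simp
  \<comment> \<open>Two steps down in u cancel the surplus 2 of
    \<open>generic_shift_b_c_g_u\<close>; the shifts of b and c cancel its second and third
    components.\<close>
  from generic_shift_add[OF generic_shift_add[OF this this]
      generic_shift_add[OF generic_shift_add[OF generic_shift_b_c_g_u generic_shift_b] generic_shift_c]]
  show ?thesis by simp
qed

theorem theorem10p1:
  shows "admits_shift_operator SE4 (\<lambda>(a, b, c, g, u). (a + 1, b, c, g, u))
    \<and> admits_shift_operator SE4 (\<lambda>(a, b, c, g, u). (a - 1, b, c, g, u))
    \<and> admits_shift_operator SE4 (\<lambda>(a, b, c, g, u). (a, b + 1, c, g, u))
    \<and> admits_shift_operator SE4 (\<lambda>(a, b, c, g, u). (a, b - 1, c, g, u))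
    \<and> admits_shift_operator SE4 (\<lambda>(a, b, c, g, u). (a, b, c + 1, g, u))
    \<and> admits_shift_operator SE4 (\<lambda>(a, b, c, g, u). (a, b, c - 1, g, u))
    \<and> admits_shift_operator SE4 (\<lambda>(a, b, c, g, u). (a, b, c, g + 2, u))
    \<and> admits_shift_operator SE4 (\<lambda>(a, b, c, g, u). (a, b, c, g - 2, u))
    \<and> admits_shift_operator SE4 (\<lambda>(a, b, c, g, u). (a, b, c, g, u + 1))
    \<and> admits_shift_operator SE4 (\<lambda>(a, b, c, g, u). (a, b, c, g, u - 1))"
proof -
  note shifts = generic_shift_a generic_shift_b generic_shift_c generic_shift_g generic_shift_u
  note admits = shifts[THEN generic_shift_imp_admits_shift_operator]
    shifts[THEN generic_shift_uminus, THEN generic_shift_imp_admits_shift_operator]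
  show ?thesis
    by (intro conjI; rule admits, force)
qed

end
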